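(* Let $N>1$, $G=\mathrm{SL}(N,\mathbf{R})$, and let $\{\nu_\alpha\mid\alpha\in A\}$ be a net of even, locally finite Borel measures on $\mathbf{R}^N$. Assume there exist $c<\infty$ and a dense set $F\subseteq G\times\mathbf{R}^+$ such that $$\lim_{\alpha\in A}\nu_\alpha(tgB)=ct^N\frac{\sigma_N}N\qquad((g,t)\in F).$$ Then $$\lim_{\alpha\in A}\int_{\mathbf{R}^N}\psi(x)\,\nu_\alpha(dx)=c\int_{\mathbf{R}^N}\psi(x)\,m(dx)\qquad(\psi\in C_c(\mathbf{R}^N)),$$ where $m(dx)$ is Lebesgue measure.
   Context: $B=B(0,1)$ is the open unit ball in $\mathbf{R}^N$; $tgB=\{tgx\mid x\in B\}$; $\mathbf{R}^+=(0,\infty)$; $\sigma_N$ is the area of the unit sphere in $\mathbf{R}^N$. A Borel measure $\nu$ on $\mathbf{R}^N$ is even if $\nu(-U)=\nu(U)$ for every Borel set $U$. *)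

theory Defs
  imports "HOL-Analysis.Analysis"
begin

definition directed_preorder :: "'i set \<Rightarrow> ('i \<Rightarrow> 'i \<Rightarrow> bool) \<Rightarrow> bool" where
  "directed_preorder A le \<longleftrightarrow>
     A \<noteq> {} \<and>
     (\<forall>a\<in>A. le a a) \<and>
     (\<forall>a\<in>A. \<forall>b\<in>A. \<forall>d\<in>A. le a b \<longrightarrow> le b d \<longrightarrow> le a d) \<and>
     (\<forall>a\<in>A. \<forall>b\<in>A. \<exists>d\<in>A. le a d \<and> le b d)"

text \<open>Filter generated by the tails of a directed set: \<open>(f \<longlongrightarrow> l) (net_filter A le)\<close> is
  Moore--Smith convergence of the net \<open>(f a)\<close>, \<open>a \<in> A\<close>, to \<open>l\<close>.\<close>

definition net_filter :: "'i set \<Rightarrow> ('i \<Rightarrow> 'i \<Rightarrow> bool) \<Rightarrow> 'i filter" where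
  "net_filter A le = (INF a\<in>A. principal {b\<in>A. le a b})"

definition locally_finite_borel_measure :: "'a::topological_space measure \<Rightarrow> bool" where
  "locally_finite_borel_measure \<nu> \<longleftrightarrow>
     sets \<nu> = sets borel \<and> (\<forall>x. \<exists>U. open U \<and> x \<in> U \<and> emeasure \<nu> U < \<infinity>)"

definition even_measure :: "'a::real_normed_vector measure \<Rightarrow> bool" where
  "even_measure \<nu> \<longleftrightarrow> (\<forall>U\<in>sets borel. emeasure \<nu> (uminus ` U) = emeasure \<nu> U)"

definition special_linear :: "(real^'n^'n) set" where
  "special_linear = {g. det g = 1}"

text \<open>Area of a hypersurface as its Minkowski content of codimension one: the volume of the
  \<open>r\<close>-neighbourhood, divided by its thickness \<open>2 * r\<close>, in the limit \<open>r \<rightarrow> 0\<close>.\<close>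

definition surface_area :: "'a::euclidean_space set \<Rightarrow> real" where
  "surface_area S = Lim (at_right 0) (\<lambda>r. measure lborel {x. infdist x S < r} / (2 * r))"

end

theory Submission
  imports Defs
begin

text \<open>
  A centred ellipsoid is a set \<open>{x. norm (L x) < r}\<close> with \<open>L\<close> linear and injective and \<open>r > 0\<close>; these are
  exactly the sets \<open>t g B\<close> with \<open>t > 0\<close> and \<open>g\<close> of determinant one. The theorem holds because Gaussians
  \<open>exp (- (norm (L x))\<^sup>2)\<close>, whose superlevel sets are centred ellipsoids if \<open>L\<close> is injective,
  have linear combinations that approximate every even test function.

  First, the convergence on the dense set \<open>F\<close> extends to every centred ellipsoid \<open>E\<close>: there
  are ellipsoids indexed by \<open>F\<close> slightly inside and slightly outside \<open>E\<close>, and measures are monotone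
  (\<open>ellipsoid_measure_convergence\<close>). The integral of a function \<open>f\<close> with values in \<open>[0, 1]\<close> is a limit
  of finite sums of measures of superlevel sets, with an error controlled by the measure
  of \<open>{0 < f}\<close> alone (\<open>integral_superlevel_approx\<close>). Hence \<open>\<integral> q d\<nu>\<close> converges
  whenever \<open>q\<close> is a Gaussian lowered by a constant and cut off at zero
  (\<open>truncated_gaussian_tendsto\<close>). The cut-off is essential, because nothing bounds
  the mass of the measures near infinity uniformly.

  Next, a sum of two squared norms \<open>(norm (L x))\<^sup>2 + (norm (L' x))\<^sup>2\<close> is again a squared norm of a
  linear image, so finite sums of Gaussians, constants included, are closed under products. They
  separate points up to sign, so Stone--Weierstrass on the one-point compactification of the
  quotient by \<open>x \<mapsto> - x\<close> applies: every even test function \<open>\<psi>\<close> satisfies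
  \<open>\<bar>\<psi> x - p x\<bar> \<le> \<epsilon> exp (- (norm x)\<^sup>2)\<close> for such a sum \<open>p\<close>
  (\<open>gaussian_sum_approximates_even\<close>, applied to \<open>\<psi>\<close> times \<open>exp ((norm x)\<^sup>2)\<close>). Cutting
  everything off at a radius \<open>R\<close> costs an error of order \<open>exp (- R\<^sup>2)\<close> on the ball of radius
  \<open>R\<close>, whose measure is eventually of order \<open>R\<^sup>N\<close>, while the term
  \<open>\<epsilon> exp (- (norm x)\<^sup>2)\<close> contributes at most a multiple of \<open>\<epsilon>\<close> that does not depend on \<open>R\<close>,
  since the Gaussian is integrable (\<open>even_test_function_tendsto\<close>). Finally, an even
  measure does not distinguish a test function from its even part.
\<close>

section \<open>Volumes of linear images and of spherical shells\<close>

text \<open>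
  The fact \<open>measure_shear_interval\<close> covers boxes on one side of the hyperplane \<open>x $ n = 0\<close>;
  a translation of the box, which the linear shear turns into another translation, gives the rest.
\<close>

lemma measure_shear_image_cbox:
  fixes a b :: "real^'n"
  assumes mn: "m \<noteq> n"
  shows "measure lebesgue ((\<lambda>x. \<chi> i. if i = m then x $ m + x $ n else x $ i) ` cbox a b)
       = measure lebesgue (cbox a b)"
proof (cases "cbox a b = {}")
  case False
  let ?S = "\<lambda>x::real^'n. \<chi> i. if i = m then x $ m + x $ n else x $ i"
  have add: "?S (x + y) = ?S x + ?S y" for x y by (simp add: vec_eq_iff)
  have "?S ` cbox a b = ?S ` (\<lambda>x. a + x) ` cbox 0 (b - a)"
    by (simp add: cbox_translation[symmetric])
  also have "\<dots> = (\<lambda>x. ?S a + x) ` ?S ` cbox 0 (b - a)"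
    by (simp only: image_image add)
  finally have "measure lebesgue (?S ` cbox a b) = measure lebesgue (?S ` cbox 0 (b - a))"
    by (simp add: measure_translation)
  also have "\<dots> = measure lebesgue (cbox 0 (b - a))"
    using False by (intro measure_shear_interval[OF mn]) (auto simp: interval_ne_empty_cart)
  also have "\<dots> = measure lebesgue ((\<lambda>x. a + x) ` cbox 0 (b - a))"
    by (simp add: measure_translation)
  finally show ?thesis
    by (simp add: cbox_translation[symmetric])
qed simp

text \<open>
  By factorization into elementary maps. A shear arises from the identity by a row operation, hence
  has determinant one. A swap of coordinates is a product of shears and sign changes, which spares a separate volume computation.
\<close>

lemma lebesgue_measure_linear_image:
  fixes f :: "real^'n \<Rightarrow> real^'n"
  assumes "linear f" "S \<in> lmeasurable"
  shows "f ` S \<in> lmeasurable \<and> measure lebesgue (f ` S) = \<bar>det (matrix f)\<bar> * measure lebesgue S"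
proof -
  define P :: "(real^'n \<Rightarrow> real^'n) \<Rightarrow> bool" where
    "P f \<longleftrightarrow> linear f \<and> (\<forall>S\<in>lmeasurable. f ` S \<in> lmeasurable \<and>
       measure lebesgue (f ` S) = \<bar>det (matrix f)\<bar> * measure lebesgue S)" for f
  have comp: "P (f \<circ> g)" if "P f" "P g" for f g
    unfolding P_def
  proof (intro conjI ballI)
    show "linear (f \<circ> g)" using that by (simp add: P_def linear_compose)
    fix S :: "(real^'n) set" assume "S \<in> lmeasurable"
    then have gS: "g ` S \<in> lmeasurable" "measure lebesgue (g ` S) = \<bar>det (matrix g)\<bar> * measure lebesgue S"
      using that by (auto simp: P_def)
    have "f ` g ` S \<in> lmeasurable" "measure lebesgue (f ` g ` S) = \<bar>det (matrix f)\<bar> * measure lebesgue (g ` S)"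
      using that gS by (auto simp: P_def)
    then show "(f \<circ> g) ` S \<in> lmeasurable"
      "measure lebesgue ((f \<circ> g) ` S) = \<bar>det (matrix (f \<circ> g))\<bar> * measure lebesgue S"
      using that gS by (auto simp: P_def image_comp matrix_compose det_mul abs_mult)
  qed
  have stretch: "P (\<lambda>x. \<chi> i. c i * x $ i)" for c
  proof -
    have "linear (\<lambda>x::real^'n. \<chi> i. c i * x $ i)"
      by (auto intro!: linearI simp: vec_eq_iff algebra_simps)
    moreover have "det (matrix (\<lambda>x::real^'n. \<chi> i. c i * x $ i)) = prod c UNIV"
      by (subst det_diagonal) (auto simp: matrix_def axis_def)
    ultimately show ?thesis
      by (simp add: P_def measurable_stretch measure_stretch)
  qed
  have shear: "P (\<lambda>x. \<chi> i. if i = m then x $ m + x $ n else x $ i)" (is "P ?s") if "m \<noteq> n" for m n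
  proof -
    have lin: "linear ?s"
      by (auto intro!: linearI simp: vec_eq_iff algebra_simps)
    have "matrix ?s = (\<chi> k. if k = m then row m (mat 1) + 1 *s row n (mat 1) else row k (mat 1))"
      by (auto simp: matrix_def axis_def row_def mat_def vec_eq_iff)
    then have "det (matrix ?s) = 1"
      by (simp only: det_row_operation[OF that] det_I)
    moreover have "?s ` S \<in> lmeasurable \<and> measure lebesgue (?s ` S) = measure lebesgue S"
      if S: "S \<in> lmeasurable" for S
      using measure_linear_sufficient[OF lin S, of 1] measure_shear_image_cbox[OF \<open>m \<noteq> n\<close>] by simp
    ultimately show ?thesis
      unfolding P_def using lin by simp
  qed
  have swap: "P (\<lambda>x. \<chi> i. x $ Transposition.transpose m n i)" if "m \<noteq> n" for m n
  proof -
    let ?s = "\<lambda>m n (x::real^'n). \<chi> i. if i = m then x $ m + x $ n else x $ i"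
    let ?d = "\<lambda>m (x::real^'n). \<chi> i. (if i = m then -1 else 1) * x $ i"
    have "(\<lambda>x. \<chi> i. x $ Transposition.transpose m n i)
        = ?d n \<circ> (?s m n \<circ> (?d m \<circ> (?s n m \<circ> (?d m \<circ> ?s m n))))"
      using that by (auto simp: fun_eq_iff vec_eq_iff Transposition.transpose_def)
    then show ?thesis
      using that by (simp only:) (intro comp stretch shear, auto)
  qed
  have "P f"
  proof (rule induct_linear_elementary[OF assms(1)])
    fix f :: "real^'n \<Rightarrow> real^'n" and i assume f: "linear f" "\<And>x. f x $ i = 0"
    then have "\<not> surj f"
      by (metis one_neq_zero surjE vec_component)
    then have "\<not> inj f" using f linear_injective_imp_surjective by blast
    then show "P f"
      using f det_nz_iff_inj[OF f(1)] negligible_linear_singular_image[of f]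
      by (auto simp: P_def negligible_iff_measure)
  qed (use comp stretch shear swap in blast)+
  then show ?thesis using assms(2) by (simp add: P_def)
qed

lemma infdist_unit_sphere:
  fixes x :: "'a::euclidean_space"
  shows "infdist x (sphere 0 1) = \<bar>norm x - 1\<bar>"
proof (rule antisym)
  have ne: "sphere (0::'a) 1 \<noteq> {}" by simp
  obtain u :: 'a where u: "norm u = 1" "x = norm x *\<^sub>R u"
  proof (cases "x = 0")
    case True
    obtain u :: 'a where "norm u = 1" using vector_choose_size[of 1] by auto
    then show ?thesis using that[of u] True by simp
  next
    case False
    then show ?thesis using that[of "sgn x"] by (simp add: norm_sgn sgn_div_norm)
  qed
  have "infdist x (sphere 0 1) \<le> dist x u"
    by (rule infdist_le) (use u in simp)
  also have "dist x u = norm ((norm x - 1) *\<^sub>R u)"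
    using u(2) by (metis dist_norm scaleR_left_diff_distrib scaleR_one)
  also have "\<dots> = \<bar>norm x - 1\<bar>" using u by simp
  finally show "infdist x (sphere 0 1) \<le> \<bar>norm x - 1\<bar>" .
  show "\<bar>norm x - 1\<bar> \<le> infdist x (sphere 0 1)"
    unfolding infdist_notempty[OF ne]
  proof (rule cINF_greatest[OF ne])
    fix y :: 'a assume "y \<in> sphere 0 1"
    then show "\<bar>norm x - 1\<bar> \<le> dist x y"
      using norm_triangle_ineq3[of x y] by (simp add: dist_norm)
  qed
qed

text \<open>The \<open>r\<close>-neighbourhood of the sphere is a spherical shell, so the Minkowski content is the
  volume of the ball times the derivative of \<open>r \<mapsto> (1 + r)\<^sup>N\<close> at \<open>0\<close>. This turns the constant
  in the hypothesis of the theorem into the volume of the ball.\<close>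

lemma surface_area_unit_sphere:
  "surface_area (sphere (0 :: 'a::euclidean_space) 1)
     = DIM('a) * measure lborel (ball (0::'a) 1)"
proof -
  let ?N = "DIM('a)" and ?v = "unit_ball_vol (DIM('a))"
  have vol: "measure lborel {x::'a. infdist x (sphere 0 1) < r} = ?v * ((1 + r) ^ ?N - (1 - r) ^ ?N)"
    if r: "0 < r" "r < 1" for r
  proof -
    have shell: "{x::'a. infdist x (sphere 0 1) < r} = ball 0 (1 + r) - cball 0 (1 - r)"
      using r by (auto simp: infdist_unit_sphere)
    have "measure lborel (ball (0::'a) (1 + r) - cball 0 (1 - r))
        = measure lborel (ball (0::'a) (1 + r)) - measure lborel (cball (0::'a) (1 - r))"
      by (rule measure_Diff)
        (use r emeasure_bounded_finite[of "ball (0::'a) (1+r)"] in \<open>auto simp: less_top\<close>)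
    then show ?thesis
      using r by (simp add: shell content_ball content_cball right_diff_distrib)
  qed
  have "((\<lambda>x::real. (1 + x) ^ ?N - (1 - x) ^ ?N) has_real_derivative 2 * real ?N) (at 0)"
    by (auto intro!: derivative_eq_intros)
  then have "((\<lambda>r. ((1 + r) ^ ?N - (1 - r) ^ ?N) / r) \<longlongrightarrow> 2 * real ?N) (at (0::real))"
    by (simp add: has_field_derivative_iff)
  then have "((\<lambda>r. ?v / 2 * (((1 + r) ^ ?N - (1 - r) ^ ?N) / r)) \<longlongrightarrow> ?v / 2 * (2 * real ?N)) (at_right (0::real))"
    by (intro tendsto_intros) (meson filterlim_at_split)
  moreover have "\<forall>\<^sub>F r in at_right 0. ?v / 2 * (((1 + r) ^ ?N - (1 - r) ^ ?N) / r)
      = measure lborel {x::'a. infdist x (sphere 0 1) < r} / (2 * r)"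
    unfolding eventually_at_right_field
    by (rule exI[of _ 1]) (auto simp: vol)
  ultimately have "((\<lambda>r. measure lborel {x::'a. infdist x (sphere 0 1) < r} / (2 * r))
      \<longlongrightarrow> ?v / 2 * (2 * real ?N)) (at_right 0)"
    by (rule Lim_transform_eventually)
  then have "surface_area (sphere (0 :: 'a) 1) = ?v / 2 * (2 * real ?N)"
    unfolding surface_area_def by (intro tendsto_Lim) auto
  then show ?thesis by (simp add: content_ball)
qed

lemma norm_matrix_vector_mult_le:
  fixes A :: "real^'n^'m"
  shows "norm (A *v x) \<le> norm A * norm x"
proof -
  have "\<bar>(A *v x) $ i\<bar> \<le> norm (A $ i) * norm x" for i
    by (simp add: matrix_vector_mul_component Cauchy_Schwarz_ineq2)
  then have "norm (A *v x) \<le> L2_set (\<lambda>i. norm (A $ i) * norm x) UNIV"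
    unfolding norm_vec_def by (intro L2_set_mono) auto
  also have "\<dots> = norm A * norm x"
    by (simp add: norm_vec_def L2_set_left_distrib)
  finally show ?thesis .
qed

lemma det_scaleR:
  fixes A :: "real^'n^'n"
  shows "det (c *\<^sub>R A) = c ^ CARD('n) * det A"
proof -
  have "c *\<^sub>R A = (\<chi> i. c *s A $ i)" by (simp add: vec_eq_iff)
  then show ?thesis using det_rows_mul[of "\<lambda>_. c" "\<lambda>i. A $ i"] by (simp add: vec_nth_inverse)
qed

text \<open>Normalise the determinant of the inverse of \<open>L\<close>: its absolute value goes into \<open>t\<close>, and
  its sign is removed by a reflection, which maps the ball to itself.\<close>

lemma ellipsoid_eq_special_linear_image:
  fixes L :: "real^'n \<Rightarrow> real^'n"
  assumes "linear L" "inj L" "r > 0"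
  obtains g t where "g \<in> special_linear" "t > 0"
    "{x. norm (L x) < r} = (\<lambda>x. t *\<^sub>R (g *v x)) ` ball 0 1"
proof -
  obtain K where K: "linear K" "\<And>x. K (L x) = x" "\<And>x. L (K x) = x"
    using linear_injective_isomorphism[OF assms(1,2)] by metis
  define d where "d = det (matrix K)"
  have "d \<noteq> 0"
  proof -
    have "matrix L ** matrix K = mat 1"
      using K assms by (simp add: matrix_compose[symmetric] o_def matrix_id_mat_1[symmetric] id_def)
    then show ?thesis unfolding d_def by (metis det_I det_mul mult_zero_right zero_neq_one)
  qed
  obtain k :: 'n where True by simp
  \<comment> \<open>the reflection, or the identity if \<open>d > 0\<close>\<close>
  define P :: "real^'n^'n" where "P = (\<chi> i j. if i = j then (if i = k then sgn d else 1) else 0)"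
  have Pv: "(P *v x) $ i = (if i = k then sgn d else 1) * x $ i" for x i
    unfolding P_def matrix_vector_mult_def
    by (simp add: if_distrib[of "\<lambda>z. z * _"] cong: if_cong)
  have [simp]: "norm (P *v x) = norm x" for x
    unfolding norm_vec_def by (rule L2_set_cong) (use \<open>d \<noteq> 0\<close> in \<open>auto simp: Pv abs_mult abs_sgn_eq\<close>)
  have PP: "P *v (P *v x) = x" for x
    using \<open>d \<noteq> 0\<close> by (auto simp: vec_eq_iff Pv sgn_if)
  have detP: "det P = sgn d"
  proof -
    have "det P = (\<Prod>i\<in>UNIV. P $ i $ i)"
      by (rule det_diagonal) (simp add: P_def)
    also have "\<dots> = sgn d" by (simp add: P_def)
    finally show ?thesis .
  qed
  define s where "s = root CARD('n) \<bar>d\<bar>"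
  have s: "s > 0" "s ^ CARD('n) = \<bar>d\<bar>"
    using \<open>d \<noteq> 0\<close> by (auto simp: s_def real_root_gt_zero)
  define g where "g = (1 / s) *\<^sub>R (matrix K ** P)"
  have "det g = (1 / s) ^ CARD('n) * (d * sgn d)"
    unfolding g_def by (simp add: det_scaleR det_mul detP d_def)
  also have "\<dots> = 1"
    using s \<open>d \<noteq> 0\<close> by (simp add: power_divide abs_sgn[symmetric])
  finally have "g \<in> special_linear" by (simp add: special_linear_def)
  moreover have "r * s > 0" using s assms by simp
  moreover have "{x. norm (L x) < r} = (\<lambda>x. (r * s) *\<^sub>R (g *v x)) ` ball 0 1"
  proof -
    have gv: "(r * s) *\<^sub>R (g *v x) = r *\<^sub>R K (P *v x)" for x
      using s K by (simp add: g_def scaleR_matrix_vector_assoc[symmetric] matrix_vector_mul_assoc[symmetric])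
    show ?thesis
      unfolding gv
    proof (intro set_eqI iffI)
      fix x assume "x \<in> {x. norm (L x) < r}"
      then have "P *v ((1/r) *\<^sub>R L x) \<in> ball 0 1" using assms by (simp)
      moreover have "x = r *\<^sub>R K (P *v (P *v ((1/r) *\<^sub>R L x)))"
        using assms K by (simp add: PP linear_cmul)
      ultimately show "x \<in> (\<lambda>x. r *\<^sub>R K (P *v x)) ` ball 0 1" by blast
    next
      fix x assume "x \<in> (\<lambda>x. r *\<^sub>R K (P *v x)) ` ball 0 1"
      then show "x \<in> {x. norm (L x) < r}" 
        using assms K by (auto simp: linear_cmul)
    qed
  qed
  ultimately show ?thesis using that by blast
qed

lemma measure_special_linear_image_ball:
  fixes g :: "real^'n^'n"
  assumes "g \<in> special_linear" "t > 0"
  shows "measure lborel ((\<lambda>x. t *\<^sub>R (g *v x)) ` ball 0 1) = t ^ CARD('n) * measure lborel (ball (0::real^'n) 1)"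
    and "open ((\<lambda>x. t *\<^sub>R (g *v x)) ` ball 0 1)"
    and "bounded ((\<lambda>x. t *\<^sub>R (g *v x)) ` ball 0 1)"
proof -
  let ?f = "\<lambda>x. t *\<^sub>R (g *v x)"
  have eq: "?f = (*v) (t *\<^sub>R g)" by (simp add: fun_eq_iff scaleR_matrix_vector_assoc)
  have lin: "linear ?f" unfolding eq by simp
  have det: "det (matrix ?f) = t ^ CARD('n)"
    unfolding eq using assms by (simp add: det_scaleR special_linear_def)
  have "invertible (t *\<^sub>R g)" using assms by (simp add: invertible_det_nz det_scaleR special_linear_def)
  then have "inj ?f" "surj ?f" unfolding eq by (auto simp: inj_matrix_vector_mult invertible_eq_bij bij_def)
  then show op: "open (?f ` ball 0 1)"
    using lin open_surjective_linear_image by blast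
  show bd: "bounded (?f ` ball 0 1)"
    by (intro bounded_linear_image linear_conv_bounded_linear[THEN iffD1] lin) simp
  have "measure lebesgue (?f ` ball 0 1) = t ^ CARD('n) * measure lebesgue (ball (0::real^'n) 1)"
    using lebesgue_measure_linear_image[OF lin, of "ball 0 1"] det assms by simp
  then show "measure lborel (?f ` ball 0 1) = t ^ CARD('n) * measure lborel (ball (0::real^'n) 1)"
    using op by (simp add: measure_completion)
qed

section \<open>From the dense set to all ellipsoids\<close>

text \<open>Bounded sets have compact closure.\<close>

lemma locally_finite_borel_measure_bounded:
  fixes \<nu> :: "'a::euclidean_space measure"
  assumes "locally_finite_borel_measure \<nu>" "bounded S"
  shows "emeasure \<nu> S < \<infinity>"
proof -
  have sets: "sets \<nu> = sets borel"
    using assms by (simp add: locally_finite_borel_measure_def)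
  obtain U where U: "\<And>x. open (U x)" "\<And>x. x \<in> U x" "\<And>x. emeasure \<nu> (U x) < \<infinity>"
    using assms(1) unfolding locally_finite_borel_measure_def by metis
  have "compact (closure S)" using assms by simp
  moreover have "\<And>x. x \<in> closure S \<Longrightarrow> open (U x)" by (rule U)
  moreover have "closure S \<subseteq> (\<Union>x\<in>closure S. U x)" using U(2) by blast
  ultimately obtain D where D: "finite D" "closure S \<subseteq> (\<Union>x\<in>D. U x)"
    by (rule compactE_image) blast
  have "emeasure \<nu> S \<le> emeasure \<nu> (\<Union>x\<in>D. U x)"
  proof (rule emeasure_mono)
    show "S \<subseteq> (\<Union>x\<in>D. U x)" using D(2) closure_subset[of S] by blast
    show "(\<Union>x\<in>D. U x) \<in> sets \<nu>" unfolding sets using U(1) by (intro borel_open open_UN) blast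
  qed
  also have "\<dots> \<le> (\<Sum>x\<in>D. emeasure \<nu> (U x))"
    using D(1) U(1) by (intro emeasure_subadditive_finite) (auto simp: sets intro: borel_open)
  also have "\<dots> < \<infinity>" using D(1) U(3) by simp
  finally show ?thesis .
qed

text \<open>For \<open>h\<close> close to \<open>g\<close> the map \<open>g\<^sup>-\<^sup>1 h\<close> is close to the identity, so changing the radius by
  a small amount absorbs the change of direction.\<close>

lemma special_linear_dense_inner_outer:
  fixes F :: "((real^'n^'n) \<times> real) set"
  assumes F: "F \<subseteq> special_linear \<times> {0<..}" "special_linear \<times> {0<..} \<subseteq> closure F"
    and g: "g \<in> special_linear" and t: "t > 0" and \<eta>: "\<eta> > 0"
  obtains g1 t1 g2 t2 where "(g1, t1) \<in> F" "(g2, t2) \<in> F" "\<bar>t1 - t\<bar> < \<eta>" "\<bar>t2 - t\<bar> < \<eta>"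
    "(\<lambda>x. t1 *\<^sub>R (g1 *v x)) ` ball 0 1 \<subseteq> (\<lambda>x. t *\<^sub>R (g *v x)) ` ball 0 1"
    "(\<lambda>x. t *\<^sub>R (g *v x)) ` ball 0 1 \<subseteq> (\<lambda>x. t2 *\<^sub>R (g2 *v x)) ` ball 0 1"
proof -
  have inv: "\<exists>h'. h ** h' = mat 1 \<and> h' ** h = mat 1" if "h \<in> special_linear" for h :: "real^'n^'n"
    using that by (metis invertible_def invertible_det_nz mem_Collect_eq special_linear_def zero_neq_one)
  obtain g' where g': "g ** g' = mat 1" "g' ** g = mat 1" using inv[OF g] by blast
  \<comment> \<open>The radii move by about \<open>\<delta> / 2\<close>, so a relative distortion \<open>\<kappa>\<close> that is small against \<open>\<delta> / t\<close> is absorbed.\<close>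
  define \<delta> where "\<delta> = min \<eta> t / 4"
  have \<delta>: "\<delta> > 0" "\<delta> < \<eta>" "4 * \<delta> \<le> t" using t \<eta> by (auto simp: \<delta>_def)
  define \<kappa> where "\<kappa> = \<delta> / (16 * t)"
  have \<kappa>: "\<kappa> > 0" "\<kappa> < 1" using \<delta> t by (auto simp: \<kappa>_def field_simps)
  have approx: "\<exists>h s. (h, s) \<in> F \<and> \<bar>s - s0\<bar> < \<delta> / 4 \<and> norm (g' ** (h - g)) < \<kappa>" if "s0 > 0" for s0
  proof -
    have "linear (\<lambda>A::real^'n^'n. g' ** A)"
      by (auto intro!: linearI simp: matrix_matrix_mult_def vec_eq_iff sum.distrib sum_distrib_left algebra_simps)
    then obtain K where K: "K > 0" "\<And>A::real^'n^'n. norm (g' ** A) \<le> norm A * K"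
      using bounded_linear.pos_bounded linear_conv_bounded_linear by metis
    have "(g, s0) \<in> closure F" using F(2) g that by auto
    moreover have "min (\<delta> / 4) (\<kappa> / K) > 0" using \<delta> \<kappa> K by simp
    ultimately obtain h s where hs: "(h, s) \<in> F" "dist (h, s) (g, s0) < min (\<delta> / 4) (\<kappa> / K)"
      by (metis closure_approachable surj_pair)
    have "dist h g < \<kappa> / K" "dist s s0 < \<delta> / 4"
      using hs(2) dist_fst_le[of "(h, s)" "(g, s0)"] dist_snd_le[of "(h, s)" "(g, s0)"] by auto
    moreover have "norm (h - g) * K < \<kappa>"
      using calculation(1) K(1) by (simp add: dist_norm field_simps)
    moreover note K(2)[of "h - g"]
    ultimately show ?thesis using hs(1) by (intro exI[of _ h] exI[of _ s]) (simp add: dist_real_def)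
  qed
  obtain g1 t1 where 1: "(g1, t1) \<in> F" "\<bar>t1 - (t - \<delta> / 2)\<bar> < \<delta> / 4" "norm (g' ** (g1 - g)) < \<kappa>"
    using approx[of "t - \<delta> / 2"] \<delta> t by auto
  obtain g2 t2 where 2: "(g2, t2) \<in> F" "\<bar>t2 - (t + \<delta> / 2)\<bar> < \<delta> / 4" "norm (g' ** (g2 - g)) < \<kappa>"
    using approx[of "t + \<delta> / 2"] \<delta> t by auto
  have inner: "(\<lambda>x. t1 *\<^sub>R (g1 *v x)) ` ball 0 1 \<subseteq> (\<lambda>x. t *\<^sub>R (g *v x)) ` ball 0 1"
  proof
    fix y assume "y \<in> (\<lambda>x. t1 *\<^sub>R (g1 *v x)) ` ball 0 1"
    then obtain x where x: "norm x < 1" "y = t1 *\<^sub>R (g1 *v x)" by auto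
    \<comment> \<open>\<open>z\<close> is the image of \<open>x\<close> under \<open>g\<^sup>-\<^sup>1 g1\<close>.\<close>
    define z where "z = x + (g' ** (g1 - g)) *v x"
    have "norm z \<le> norm x + norm (g' ** (g1 - g)) * norm x"
      unfolding z_def by (intro norm_triangle_le add_left_mono norm_matrix_vector_mult_le)
    also have "\<dots> \<le> 1 + \<kappa> * 1"
      using x 1 \<kappa> by (intro add_mono mult_mono) auto
    finally have z: "norm z \<le> 1 + \<kappa>" by simp
    have gz: "g *v z = g1 *v x"
      unfolding z_def matrix_vector_right_distrib matrix_vector_mul_assoc matrix_mul_assoc g'
      by (simp add: matrix_vector_mult_diff_rdistrib)
    have t1: "0 < t1" "t1 < t - \<delta> / 4" using 1(2)[unfolded abs_less_iff] \<delta> t by linarith+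
    have "t1 * (1 + \<kappa>) \<le> (t - \<delta> / 4) * (1 + \<kappa>)" using t1 \<kappa> by (intro mult_right_mono) auto
    also have "\<dots> < t" using \<delta> t by (simp add: \<kappa>_def field_simps add_pos_pos)
    finally have "t1 * norm z < t" using z t1 by (smt (verit) mult_left_mono)
    then have "norm ((t1 / t) *\<^sub>R z) < 1" using t t1 by (simp add: field_simps)
    moreover have "y = t *\<^sub>R (g *v ((t1 / t) *\<^sub>R z))"
      using t by (simp add: matrix_vector_mult_scaleR gz x)
    ultimately show "y \<in> (\<lambda>x. t *\<^sub>R (g *v x)) ` ball 0 1" by auto
  qed
  have outer: "(\<lambda>x. t *\<^sub>R (g *v x)) ` ball 0 1 \<subseteq> (\<lambda>x. t2 *\<^sub>R (g2 *v x)) ` ball 0 1"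
  proof
    fix y assume "y \<in> (\<lambda>x. t *\<^sub>R (g *v x)) ` ball 0 1"
    then obtain x where x: "norm x < 1" "y = t *\<^sub>R (g *v x)" by auto
    obtain g2' where g2': "g2 ** g2' = mat 1" using inv F(1) 2 by blast
    \<comment> \<open>\<open>z - x\<close> is bounded through \<open>g\<^sup>-\<^sup>1 (g2 - g) z\<close>, which avoids estimating the inverse of \<open>g2\<close>.\<close>
    define z where "z = (g2' ** g) *v x"
    have gz: "g2 *v z = g *v x"
      by (simp add: z_def matrix_vector_mul_assoc matrix_mul_assoc g2')
    have "(g' ** (g2 - g)) *v z = g' *v (g2 *v z) - (g' ** g) *v z"
      by (simp add: matrix_vector_mul_assoc[symmetric] matrix_vector_mult_diff_rdistrib matrix_vector_mult_diff_distrib)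
    also have "\<dots> = x - z" by (simp add: gz matrix_vector_mul_assoc g')
    finally have "norm z \<le> norm x + norm ((g' ** (g2 - g)) *v z)"
      using norm_triangle_ineq4[of x "x - z"] by simp
    also have "\<dots> \<le> norm x + \<kappa> * norm z"
      using 2(3) norm_matrix_vector_mult_le[of "g' ** (g2 - g)" z]
      by (smt (verit) mult_right_mono norm_ge_zero)
    finally have z: "(1 - \<kappa>) * norm z < 1" using x by (simp add: algebra_simps)
    have t2: "t + \<delta> / 4 < t2" using 2(2)[unfolded abs_less_iff] by linarith
    have "\<delta> * \<delta> < t * (12 * \<delta>)" using \<delta> t by (simp add: mult.commute)
    then have "t < (t + \<delta> / 4) * (1 - \<kappa>)" using \<delta> t by (simp add: \<kappa>_def field_simps)
    also have "\<dots> \<le> t2 * (1 - \<kappa>)" using t2 \<kappa> by (intro mult_right_mono) auto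
    finally have tt: "t / t2 < 1 - \<kappa>" using t2 t \<delta> by (simp add: field_simps)
    have "(t / t2) * norm z \<le> (1 - \<kappa>) * norm z" using tt by (intro mult_right_mono) auto
    with z have "(t / t2) * norm z < 1" by linarith
    moreover have "t2 > 0" using t t2 \<delta> by linarith
    ultimately have "norm ((t / t2) *\<^sub>R z) < 1" using t by simp
    moreover have "y = t2 *\<^sub>R (g2 *v ((t / t2) *\<^sub>R z))"
      using t t2 \<delta> by (simp add: matrix_vector_mult_scaleR gz x)
    ultimately show "y \<in> (\<lambda>x. t2 *\<^sub>R (g2 *v x)) ` ball 0 1" by auto
  qed
  show ?thesis
  proof (rule that[OF 1(1) 2(1) _ _ inner outer])
    show "\<bar>t1 - t\<bar> < \<eta>" "\<bar>t2 - t\<bar> < \<eta>"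
      using 1(2)[unfolded abs_less_iff] 2(2)[unfolded abs_less_iff] \<delta> unfolding abs_less_iff by linarith+
  qed
qed

lemma ellipsoid_measure_convergence:
  fixes \<nu> :: "'i \<Rightarrow> (real^'n) measure" and F :: "((real^'n^'n) \<times> real) set"
  assumes \<nu>: "\<forall>\<^sub>F \<alpha> in \<F>. locally_finite_borel_measure (\<nu> \<alpha>)"
    and F: "F \<subseteq> special_linear \<times> {0<..}" "special_linear \<times> {0<..} \<subseteq> closure F"
    and lim: "\<And>g t. (g, t) \<in> F \<Longrightarrow>
       ((\<lambda>\<alpha>. measure (\<nu> \<alpha>) ((\<lambda>x. t *\<^sub>R (g *v x)) ` ball 0 1))
          \<longlongrightarrow> c * t ^ CARD('n) * measure lborel (ball (0::real^'n) 1)) \<F>"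
    and L: "linear L" "inj L"
  shows "((\<lambda>\<alpha>. measure (\<nu> \<alpha>) {x. norm (L x) < r}) \<longlongrightarrow> c * measure lborel {x::real^'n. norm (L x :: real^'n) < r}) \<F>"
proof (cases "r > 0")
  case False
  then have "{x. norm (L x) < r} = {}" by (smt (verit) Collect_empty_eq norm_ge_zero)
  then show ?thesis by simp
next
  case True
  let ?E = "\<lambda>g t. (\<lambda>x. t *\<^sub>R (g *v x)) ` ball (0::real^'n) 1" and ?v = "measure lborel (ball (0::real^'n) 1)"
  obtain g t where g: "g \<in> special_linear" "t > 0" and E: "{x. norm (L x) < r} = ?E g t"
    using ellipsoid_eq_special_linear_image[OF L True] .
  let ?l = "\<lambda>t. c * t ^ CARD('n) * ?v"
  have "((\<lambda>\<alpha>. measure (\<nu> \<alpha>) (?E g t)) \<longlongrightarrow> ?l t) \<F>"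
  proof (rule tendstoI)
    fix e :: real assume e: "e > 0"
    have "isCont ?l t" by (intro continuous_intros)
    then obtain \<eta> where \<eta>: "\<eta> > 0" "\<And>s. \<bar>s - t\<bar> < \<eta> \<Longrightarrow> \<bar>?l s - ?l t\<bar> < e / 2"
      using e unfolding continuous_at_eps_delta dist_real_def by (metis half_gt_zero)
    obtain g1 t1 g2 t2 where 1: "(g1, t1) \<in> F" "(g2, t2) \<in> F" "\<bar>t1 - t\<bar> < \<eta>" "\<bar>t2 - t\<bar> < \<eta>"
      "?E g1 t1 \<subseteq> ?E g t" "?E g t \<subseteq> ?E g2 t2"
      using special_linear_dense_inner_outer[OF F g \<eta>(1)] .
    have ev1: "\<forall>\<^sub>F \<alpha> in \<F>. \<bar>measure (\<nu> \<alpha>) (?E g1 t1) - ?l t1\<bar> < e / 2"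
      using tendstoD[OF lim[OF 1(1)], of "e/2"] e by (simp add: dist_real_def)
    have ev2: "\<forall>\<^sub>F \<alpha> in \<F>. \<bar>measure (\<nu> \<alpha>) (?E g2 t2) - ?l t2\<bar> < e / 2"
      using tendstoD[OF lim[OF 1(2)], of "e/2"] e by (simp add: dist_real_def)
    have g12: "g1 \<in> special_linear" "t1 > 0" "g2 \<in> special_linear" "t2 > 0" using F 1 by auto
    show "\<forall>\<^sub>F \<alpha> in \<F>. dist (measure (\<nu> \<alpha>) (?E g t)) (?l t) < e"
      using \<nu> ev1 ev2
    proof eventually_elim
      case (elim \<alpha>)
      have sets: "?E g t \<in> sets (\<nu> \<alpha>)" "?E g1 t1 \<in> sets (\<nu> \<alpha>)" "?E g2 t2 \<in> sets (\<nu> \<alpha>)"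
        using elim(1) measure_special_linear_image_ball(2)[OF g] measure_special_linear_image_ball(2)[OF g12(1,2)]
          measure_special_linear_image_ball(2)[OF g12(3,4)] by (auto simp: locally_finite_borel_measure_def)
      have fin: "emeasure (\<nu> \<alpha>) (?E g t) < \<infinity>" "emeasure (\<nu> \<alpha>) (?E g2 t2) < \<infinity>"
        by (rule locally_finite_borel_measure_bounded[OF elim(1)]
              measure_special_linear_image_ball(3)[OF g] measure_special_linear_image_ball(3)[OF g12(3,4)])+
      have "measure (\<nu> \<alpha>) (?E g1 t1) \<le> measure (\<nu> \<alpha>) (?E g t)"
        "measure (\<nu> \<alpha>) (?E g t) \<le> measure (\<nu> \<alpha>) (?E g2 t2)"
        using 1 sets fin by (auto intro!: measure_mono_fmeasurable fmeasurableI)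
      with elim \<eta>(2)[OF 1(3)] \<eta>(2)[OF 1(4)] show ?case
        unfolding dist_real_def by linarith
    qed
  qed
  then show ?thesis
    by (simp add: E measure_special_linear_image_ball[OF g] mult.assoc)
qed

section \<open>Integrals from superlevel sets\<close>

text \<open>The sum counts the \<open>k\<close> with \<open>k < n * y\<close>, so it is the ceiling of \<open>n * y\<close>.\<close>

lemma step_approx:
  fixes y :: real
  assumes "0 \<le> y" "y \<le> 1" "n > 0"
  shows "\<bar>y - (\<Sum>k<n. of_bool (real k / n < y)) / n\<bar> \<le> of_bool (0 < y) / n"
proof -
  have "{k. k < n \<and> real k / n < y} = {..<nat \<lceil>n * y\<rceil>}"
  proof (intro set_eqI iffI)
    fix k assume "k \<in> {..<nat \<lceil>n * y\<rceil>}"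
    then have ky: "real k < n * y" by (simp add: zless_nat_eq_int_zless less_ceiling_iff)
    also have "n * y \<le> n * (1::real)" using assms by (intro mult_left_mono) auto
    finally have "k < n" by simp
    moreover have "real k / n < y" using ky assms by (simp add: field_simps)
    ultimately show "k \<in> {k. k < n \<and> real k / n < y}" by simp
  qed (use assms in \<open>auto simp: zless_nat_eq_int_zless less_ceiling_iff field_simps\<close>)
  then have "(\<Sum>k<n. of_bool (real k / n < y)) = real (nat \<lceil>n * y\<rceil>)"
    by (simp add: sum.If_cases of_bool_def Int_def lessThan_def)
  also have "\<dots> = of_int \<lceil>n * y\<rceil>" using assms by simp
  finally have eq: "(\<Sum>k<n. of_bool (real k / n < y)) = real_of_int \<lceil>n * y\<rceil>" .
  have "\<bar>y - of_int \<lceil>n * y\<rceil> / n\<bar> = \<bar>n * y - of_int \<lceil>n * y\<rceil>\<bar> / n"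
    using assms by (simp add: field_simps abs_if)
  also have "\<dots> \<le> of_bool (0 < y) / n"
    using assms by (intro divide_right_mono) (auto simp: abs_le_iff intro: less_imp_le, linarith+)
  finally show ?thesis unfolding eq .
qed

lemma integrable_bounded_support:
  fixes f :: "'a \<Rightarrow> real"
  assumes "f \<in> borel_measurable M" "A \<in> sets M" "emeasure M A < \<infinity>"
    "\<And>x. x \<in> space M \<Longrightarrow> \<bar>f x\<bar> \<le> K" "\<And>x. x \<in> space M \<Longrightarrow> x \<notin> A \<Longrightarrow> f x = 0"
  shows "integrable M f"
proof (rule Bochner_Integration.integrable_bound)
  show "integrable M (\<lambda>x. K * indicator A x)" using assms by simp
  show "AE x in M. norm (f x) \<le> norm (K * indicator A x)"
    using assms(4,5) by (intro AE_I2) (force simp: indicator_def)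
qed fact

text \<open>The bound depends on the measure only through \<open>{0 < f}\<close>. That uniformity
  is what allows a limit along a net, where dominated convergence is not available.\<close>

lemma integral_superlevel_approx:
  fixes f :: "'a \<Rightarrow> real"
  assumes f: "f \<in> borel_measurable M" "\<And>x. 0 \<le> f x" "\<And>x. f x \<le> 1"
    and fin: "emeasure M {x\<in>space M. 0 < f x} < \<infinity>" and n: "n > 0"
  shows "\<bar>(LINT x|M. f x) - (\<Sum>k<n. measure M {x\<in>space M. real k / n < f x}) / n\<bar>
    \<le> measure M {x\<in>space M. 0 < f x} / n"
proof -
  let ?A = "\<lambda>s. {x\<in>space M. s < f x}"
  have meas[measurable]: "?A s \<in> sets M" for s using f(1) by measurable
  have finA: "emeasure M (?A s) < \<infinity>" if "s \<ge> 0" for s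
    using that by (intro le_less_trans[OF emeasure_mono fin]) auto
  have intA: "integrable M (indicat_real (?A s))" if "s \<ge> 0" for s
    using finA[OF that] by simp
  have intf: "integrable M f"
    by (rule integrable_bounded_support[OF f(1) meas[of 0] fin, of 1]) (use f(2,3) in \<open>auto simp: abs_le_iff not_less intro: antisym order_trans[of _ 0]\<close>)
  define g where "g x = (\<Sum>k<n. indicat_real (?A (real k / n)) x) / n" for x
  have intg: "integrable M g"
    unfolding g_def by (intro Bochner_Integration.integrable_divide Bochner_Integration.integrable_sum intA) auto
  have "(LINT x|M. g x) = (\<Sum>k<n. measure M (?A (real k / n))) / n"
    unfolding g_def by (simp add: Bochner_Integration.integral_sum intA)
  then have "\<bar>(LINT x|M. f x) - (\<Sum>k<n. measure M (?A (real k / n))) / n\<bar> = \<bar>LINT x|M. f x - g x\<bar>"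
    by (simp add: intf intg)
  also have "\<dots> \<le> (LINT x|M. \<bar>f x - g x\<bar>)" by (rule integral_abs_bound)
  also have "\<dots> \<le> (LINT x|M. indicat_real (?A 0) x / n)"
  proof (rule integral_mono)
    show "integrable M (\<lambda>x. \<bar>f x - g x\<bar>)" using intf intg by auto
    show "integrable M (\<lambda>x. indicat_real (?A 0) x / n)" using intA[of 0] by auto
    fix x assume "x \<in> space M"
    then show "\<bar>f x - g x\<bar> \<le> indicat_real (?A 0) x / n"
      using step_approx[of "f x" n] f(2,3) n by (simp add: g_def indicator_def of_bool_def)
  qed
  also have "\<dots> = measure M (?A 0) / n" by simp
  finally show ?thesis .
qed

lemma integral_tendsto_of_superlevels:
  fixes f :: "'a::euclidean_space \<Rightarrow> real"
  assumes \<nu>: "\<forall>\<^sub>F \<alpha> in \<F>. locally_finite_borel_measure (\<nu> \<alpha>)"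
    and f: "f \<in> borel_measurable borel" "\<And>x. 0 \<le> f x" "\<And>x. f x \<le> 1"
    and bd: "bounded {x. 0 < f x}"
    and lim: "\<And>s. s \<ge> 0 \<Longrightarrow> ((\<lambda>\<alpha>. measure (\<nu> \<alpha>) {x. s < f x}) \<longlongrightarrow> c * measure lborel {x. s < f x}) \<F>"
  shows "((\<lambda>\<alpha>. LINT x|\<nu> \<alpha>. f x) \<longlongrightarrow> c * (LINT x|lborel. f x)) \<F>"
proof (rule tendstoI)
  fix e :: real assume e: "e > 0"
  let ?m = "measure lborel {x. 0 < f x}"
  define K where "K = \<bar>c\<bar> * ?m + 1"
  have K: "K > 0" by (simp add: K_def add_nonneg_pos)
  obtain n :: nat where n: "3 * K / e < n" using reals_Archimedean2 by blast
  moreover have "0 < 3 * K / e" using K e by simp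
  ultimately have n0: "n > 0" using gr0I by fastforce
  have Kn: "K / n < e / 3" using n e n0 by (simp add: field_simps)
  let ?S = "\<lambda>M. (\<Sum>k<n. measure M {x. real k / n < f x}) / n"
  have "((\<lambda>\<alpha>. ?S (\<nu> \<alpha>)) \<longlongrightarrow> (\<Sum>k<n. c * measure lborel {x. real k / n < f x}) / n) \<F>"
    using n0 by (intro tendsto_intros lim) auto
  then have "((\<lambda>\<alpha>. ?S (\<nu> \<alpha>)) \<longlongrightarrow> c * ?S lborel) \<F>"
    by (simp add: sum_distrib_left)
  then have ev1: "\<forall>\<^sub>F \<alpha> in \<F>. \<bar>?S (\<nu> \<alpha>) - c * ?S lborel\<bar> < e / 3"
    using tendstoD[of _ _ _ "e / 3"] e by (fastforce simp: dist_real_def)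
  have "\<forall>\<^sub>F \<alpha> in \<F>. measure (\<nu> \<alpha>) {x. 0 < f x} < c * ?m + 1"
    using order_tendstoD(2)[OF lim[of 0]] by simp
  then have ev2: "\<forall>\<^sub>F \<alpha> in \<F>. measure (\<nu> \<alpha>) {x. 0 < f x} \<le> K"
  proof eventually_elim
    case (elim \<alpha>)
    have "c * ?m \<le> \<bar>c\<bar> * ?m" by (intro mult_right_mono) auto
    then show ?case using elim by (simp add: K_def)
  qed
  have "\<bar>(LINT x|lborel. f x) - ?S lborel\<bar> \<le> ?m / n"
    using integral_superlevel_approx[of f lborel n] f n0 emeasure_bounded_finite[OF bd] by simp
  then have "\<bar>c\<bar> * \<bar>(LINT x|lborel. f x) - ?S lborel\<bar> \<le> \<bar>c\<bar> * (?m / n)"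
    by (intro mult_left_mono) auto
  also have "\<dots> \<le> K / n" by (simp add: K_def divide_right_mono)
  finally have m: "\<bar>c * (LINT x|lborel. f x) - c * ?S lborel\<bar> \<le> K / n"
    by (simp add: abs_mult[symmetric] right_diff_distrib)
  show "\<forall>\<^sub>F \<alpha> in \<F>. dist (LINT x|\<nu> \<alpha>. f x) (c * (LINT x|lborel. f x)) < e"
    using \<nu> ev1 ev2
  proof eventually_elim
    case (elim \<alpha>)
    have s: "sets (\<nu> \<alpha>) = sets borel" using elim(1) by (simp add: locally_finite_borel_measure_def)
    then have sp: "space (\<nu> \<alpha>) = UNIV" using sets_eq_imp_space_eq by fastforce
    have "\<bar>(LINT x|\<nu> \<alpha>. f x) - ?S (\<nu> \<alpha>)\<bar> \<le> measure (\<nu> \<alpha>) {x. 0 < f x} / n"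
      using integral_superlevel_approx[of f "\<nu> \<alpha>" n] f n0 locally_finite_borel_measure_bounded[OF elim(1) bd]
      by (simp add: sp measurable_cong_sets[OF s])
    also have "\<dots> \<le> K / n" using elim by (intro divide_right_mono) auto
    finally show ?case
      using elim(2) m Kn unfolding dist_real_def by linarith
  qed
qed

text \<open>
  A Gaussian cut off along its own level set \<open>norm (L x) = R\<close>, so that all superlevel sets
  remain centred ellipsoids; subtracting \<open>exp (- R\<^sup>2)\<close> makes the cut continuous.
\<close>

definition truncated_gaussian :: "real \<Rightarrow> ('a::real_normed_vector \<Rightarrow> 'b::real_normed_vector) \<Rightarrow> 'a \<Rightarrow> real" where
  "truncated_gaussian R L x = max 0 (exp (- (norm (L x))\<^sup>2) - exp (- R\<^sup>2))"

text \<open>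
  Taking logarithms turns the superlevel set into an ellipsoid. If \<open>s + exp (- R\<^sup>2) \<ge> 1\<close>, it is
  empty and \<open>r = 0\<close> serves.
\<close>

lemma truncated_gaussian_superlevel:
  assumes "s \<ge> 0"
  obtains r where "{x. s < truncated_gaussian R L x} = {x. norm (L x) < r}"
proof (cases "s + exp (- R\<^sup>2) < 1")
  case True
  define r where "r = sqrt (- ln (s + exp (- R\<^sup>2)))"
  have p: "s + exp (- R\<^sup>2) > 0" using assms by (simp add: add_nonneg_pos)
  then have l: "- ln (s + exp (- R\<^sup>2)) > 0" using True by simp
  have "s < truncated_gaussian R L x \<longleftrightarrow> norm (L x) < r" for x
  proof -
    have "s < truncated_gaussian R L x \<longleftrightarrow> exp (ln (s + exp (- R\<^sup>2))) < exp (- (norm (L x))\<^sup>2)"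
      using assms p by (auto simp: truncated_gaussian_def)
    also have "\<dots> \<longleftrightarrow> (norm (L x))\<^sup>2 < - ln (s + exp (- R\<^sup>2))"
      by (simp only: exp_less_cancel_iff) linarith
    also have "\<dots> \<longleftrightarrow> norm (L x) < r"
      using l unfolding r_def by (smt (verit) norm_ge_zero real_less_lsqrt real_less_rsqrt real_sqrt_less_iff real_sqrt_power real_sqrt_abs real_sqrt_unique)
    finally show ?thesis .
  qed
  then show ?thesis using that by auto
next
  case False
  have "\<not> s < truncated_gaussian R L x" for x
  proof -
    have "exp (- (norm (L x))\<^sup>2) \<le> 1" by simp
    then show ?thesis using assms False unfolding truncated_gaussian_def by linarith
  qed
  moreover have "{x. norm (L x) < 0} = {}" by (auto simp: not_less)
  ultimately show ?thesis using that[of 0] by auto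
qed

lemma truncated_gaussian_support:
  assumes "R > 0"
  shows "0 < truncated_gaussian R L x \<longleftrightarrow> norm (L x) < R"
proof -
  have "norm (L x) < R \<longleftrightarrow> (norm (L x))\<^sup>2 < R\<^sup>2"
    using assms by (meson less_imp_le norm_ge_zero power2_less_imp_less power_strict_mono pos2)
  then show ?thesis by (simp add: truncated_gaussian_def less_max_iff_disj)
qed

lemma truncated_gaussian_bounds:
  "0 \<le> truncated_gaussian R L x" "truncated_gaussian R L x \<le> 1"
  "\<bar>exp (- (norm (L x))\<^sup>2) - truncated_gaussian R L x\<bar> \<le> exp (- R\<^sup>2)"
proof -
  have "exp (- (norm (L x))\<^sup>2) \<le> 1" by simp
  moreover have "0 < exp (- R\<^sup>2)" "0 < exp (- (norm (L x))\<^sup>2)" by simp_all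
  ultimately show "0 \<le> truncated_gaussian R L x" "truncated_gaussian R L x \<le> 1"
    "\<bar>exp (- (norm (L x))\<^sup>2) - truncated_gaussian R L x\<bar> \<le> exp (- R\<^sup>2)"
    unfolding truncated_gaussian_def by linarith+
qed

lemma truncated_gaussian_measurable:
  fixes L :: "'a::euclidean_space \<Rightarrow> 'b::euclidean_space"
  assumes "linear L"
  shows "truncated_gaussian R L \<in> borel_measurable borel"
proof (rule borel_measurable_continuous_onI)
  have "continuous_on UNIV L"
    using assms by (simp add: linear_continuous_on linear_conv_bounded_linear)
  then show "continuous_on UNIV (truncated_gaussian R L)"
    unfolding truncated_gaussian_def[abs_def] by (intro continuous_intros)
qed

lemma bounded_ellipsoid:
  fixes L :: "'a::euclidean_space \<Rightarrow> 'b::euclidean_space"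
  assumes "linear L" "inj L"
  shows "bounded {x. norm (L x) < r}"
proof -
  obtain B where B: "B > 0" "\<And>x. B * norm x \<le> norm (L x)"
    using linear_inj_bounded_below_pos[OF assms] by blast
  have "norm x \<le> r / B" if "norm (L x) < r" for x
    using B(1) B(2)[of x] that by (simp add: field_simps)
  then show ?thesis by (auto intro!: boundedI)
qed

text \<open>
  For \<open>k \<le> norm x < k + 1\<close> the Gaussian is at most \<open>exp (- k)\<close>, so it is bounded by the sum of
  \<open>exp (- k)\<close> times the indicators of the balls of radius \<open>k + 1\<close>, whose volumes grow
  only polynomially in \<open>k\<close>.
\<close>

lemma gaussian_integrable:
  "integrable lborel (\<lambda>x::'a::euclidean_space. exp (- (norm x)\<^sup>2))"
proof (rule integrableI_bounded)
  show "(\<lambda>x::'a. exp (- (norm x)\<^sup>2)) \<in> borel_measurable lborel" by measurable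
  let ?N = "DIM('a)" and ?v = "unit_ball_vol (DIM('a))"
  have le: "ennreal (norm (exp (- (norm x)\<^sup>2))) \<le> (\<Sum>k. ennreal (exp (- real k)) * indicator (ball 0 (real k + 1)) x)" for x :: 'a
  proof -
    define k where "k = nat \<lfloor>norm x\<rfloor>"
    have k: "real k \<le> norm x" "norm x < real k + 1"
      by (simp_all add: k_def of_nat_nat)
    have "real k \<le> (real k)\<^sup>2" by (simp add: power2_eq_square flip: of_nat_mult)
    also have "\<dots> \<le> (norm x)\<^sup>2" using k by (intro power_mono) auto
    finally have "ennreal (norm (exp (- (norm x)\<^sup>2))) \<le> ennreal (exp (- real k)) * indicator (ball 0 (real k + 1)) x"
      using k by (simp add: ennreal_leI)
    also have "\<dots> \<le> (\<Sum>k. ennreal (exp (- real k)) * indicator (ball 0 (real k + 1)) x)"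
      using sum_le_suminf[of "\<lambda>k. ennreal (exp (- real k)) * indicator (ball 0 (real k + 1)) x" "{k}"]
      by (simp only: sum.insert sum.empty finite.intros empty_iff not_False_eq_True add_0_right)
        (simp add: summableI)
    finally show ?thesis .
  qed
  have "(\<integral>\<^sup>+ x. ennreal (norm (exp (- (norm (x::'a))\<^sup>2))) \<partial>lborel)
      \<le> (\<integral>\<^sup>+ x. (\<Sum>k. ennreal (exp (- real k)) * indicator (ball 0 (real k + 1)) (x::'a)) \<partial>lborel)"
    by (intro nn_integral_mono le)
  also have "\<dots> = (\<Sum>k. \<integral>\<^sup>+ x. ennreal (exp (- real k)) * indicator (ball 0 (real k + 1)) (x::'a) \<partial>lborel)"
    by (intro nn_integral_suminf borel_measurable_times_ennreal borel_measurable_const borel_measurable_indicator) auto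
  also have "\<dots> = (\<Sum>k. ennreal (exp (- real k)) * emeasure lborel (ball (0::'a) (real k + 1)))"
    by (simp add: nn_integral_cmult_indicator)
  also have "\<dots> = (\<Sum>k. ennreal (?v * (exp (- real k) * (real k + 1) ^ ?N)))"
    by (simp add: emeasure_ball ennreal_mult[symmetric] mult_ac)
  also have "\<dots> < \<infinity>"
  proof -
    have "((\<lambda>x::real. x ^ ?N / exp x) \<longlongrightarrow> 0) at_top" by (rule tendsto_power_div_exp_0)
    moreover have "filterlim (\<lambda>k. (real k + 1) / 2) at_top sequentially"
    proof -
      have "filterlim (\<lambda>k. 1 / 2 * (1 + real k)) at_top sequentially"
        by (intro filterlim_tendsto_pos_mult_at_top[OF tendsto_const]
            filterlim_tendsto_add_at_top[OF tendsto_const] filterlim_real_sequentially) simp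
      then show ?thesis by (simp add: add.commute)
    qed
    ultimately have "((\<lambda>k. ((real k + 1) / 2) ^ ?N / exp ((real k + 1) / 2)) \<longlongrightarrow> 0) sequentially"
      by (rule filterlim_compose)
    then have "\<forall>\<^sub>F k in sequentially. ((real k + 1) / 2) ^ ?N / exp ((real k + 1) / 2) < 1"
      by (rule order_tendstoD) simp
    then have "\<forall>\<^sub>F k in sequentially. norm (exp (- real k) * (real k + 1) ^ ?N) \<le> 2 ^ ?N * exp (1/2) * exp (- 1 / 2) ^ k"
    proof eventually_elim
      case (elim k)
      then have "(real k + 1) ^ ?N \<le> 2 ^ ?N * exp ((real k + 1) / 2)" by (simp add: power_divide field_simps)
      then have "exp (- real k) * (real k + 1) ^ ?N \<le> exp (- real k) * (2 ^ ?N * exp ((real k + 1) / 2))" by simp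
      also have "\<dots> = 2 ^ ?N * exp (1/2) * exp (- 1 / 2) ^ k"
        by (simp add: exp_of_nat_mult[symmetric] exp_add[symmetric] field_simps)
      finally show ?case by simp
    qed
    moreover have "summable (\<lambda>k. 2 ^ ?N * exp (1/2) * exp (- 1 / 2 :: real) ^ k)"
      by (intro summable_mult summable_geometric) simp
    ultimately have "summable (\<lambda>k. exp (- real k) * (real k + 1) ^ ?N)"
      by (rule summable_comparison_test_ev)
    then have "(\<Sum>k. ennreal (?v * (exp (- real k) * (real k + 1) ^ ?N))) \<noteq> top"
      by (intro ennreal_suminf_neq_top summable_mult) auto
    then show ?thesis by (simp add: less_top)
  qed
  finally show "(\<integral>\<^sup>+ x. ennreal (norm (exp (- (norm (x::'a))\<^sup>2))) \<partial>lborel) < \<infinity>" .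
qed

section \<open>Gaussian sums and the Stone--Weierstrass theorem\<close>

text \<open>The map \<open>x \<mapsto> (L1 x, L2 x)\<close> has the right norm but the wrong codomain. Its range has at most the
  dimension of the domain, so it embeds isometrically there. This replaces a
  square root of the positive semidefinite form.\<close>

lemma exists_linear_norm_square_add:
  fixes L1 :: "'a::euclidean_space \<Rightarrow> 'b::euclidean_space" and L2 :: "'a \<Rightarrow> 'c::euclidean_space"
  assumes "linear L1" "linear L2"
  shows "\<exists>L :: 'a \<Rightarrow> 'a. linear L \<and> (\<forall>x. (norm (L x))\<^sup>2 = (norm (L1 x))\<^sup>2 + (norm (L2 x))\<^sup>2)"
proof -
  let ?A = "\<lambda>x. (L1 x, L2 x)"
  have A: "linear ?A"
    using assms by (auto intro!: linearI simp: linear_add linear_cmul)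
  have "dim (range ?A) \<le> dim (UNIV :: 'a set)"
    by (rule dim_image_le[OF A])
  then obtain f :: "'b \<times> 'c \<Rightarrow> 'a" where f: "linear f" "\<And>x. x \<in> range ?A \<Longrightarrow> norm (f x) = norm x"
    using isometry_subset_subspace[OF linear_subspace_image[OF A subspace_UNIV] subspace_UNIV] by metis
  have "linear (\<lambda>x. f (?A x))" using linear_compose[OF A f(1)] by (simp add: o_def)
  moreover have "(norm (f (?A x)))\<^sup>2 = (norm (L1 x))\<^sup>2 + (norm (L2 x))\<^sup>2" for x
    using f(2)[of "?A x"] by (simp add: norm_Pair)
  ultimately show ?thesis by blast
qed

text \<open>
  The map \<open>L\<close> may be singular; in particular constants are Gaussian sums.
\<close>

inductive gaussian_sum :: "('a::euclidean_space \<Rightarrow> real) \<Rightarrow> bool" where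
  gaussian: "linear L \<Longrightarrow> gaussian_sum (\<lambda>x. a * exp (- (norm (L x :: 'a))\<^sup>2))"
| add: "gaussian_sum v \<Longrightarrow> gaussian_sum w \<Longrightarrow> gaussian_sum (\<lambda>x. v x + w x)"

lemma gaussian_sum_const: "gaussian_sum (\<lambda>_::'a::euclidean_space. a)"
proof -
  have "linear (\<lambda>x::'a. 0::'a)" by (rule linear_zero)
  from gaussian_sum.gaussian[OF this, of a] show ?thesis by simp
qed

lemma gaussian_sum_mult:
  assumes "gaussian_sum v" "gaussian_sum w"
  shows "gaussian_sum (\<lambda>x. v x * w x)"
  using assms(1)
proof induction
  case (gaussian L a)
  from assms(2) show ?case
  proof induction
    case (gaussian L' b)
    obtain M where M: "linear M" "\<And>x. (norm (M x :: 'a))\<^sup>2 = (norm (L x))\<^sup>2 + (norm (L' x))\<^sup>2"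
      using exists_linear_norm_square_add[OF \<open>linear L\<close> \<open>linear L'\<close>] by blast
    have "(\<lambda>x. a * exp (- (norm (L x))\<^sup>2) * (b * exp (- (norm (L' x))\<^sup>2)))
        = (\<lambda>x. a * b * exp (- (norm (M x))\<^sup>2))"
      by (simp add: M(2) mult_exp_exp[symmetric] fun_eq_iff exp_diff exp_minus field_simps)
    then show ?case
      using gaussian_sum.gaussian[OF M(1), of "a * b"] by simp
  next
    case (add v w)
    then show ?case using gaussian_sum.add by (simp add: distrib_left)
  qed
next
  case (add v w)
  then show ?case using gaussian_sum.add by (simp add: distrib_right)
qed

text \<open>
  Finitely many Gaussians that together separate points up to sign. The summand \<open>(norm x)\<^sup>2\<close>
  makes every entry vanish at infinity.
\<close>

definition gaussian_embedding :: "real^'n \<Rightarrow> real^'n^'n" where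
  "gaussian_embedding x = (\<chi> i j. exp (- ((norm x)\<^sup>2 + (x $ i + x $ j)\<^sup>2)))"

text \<open>The entries determine \<open>norm x\<close>, by summing the exponents on the diagonal, and then all
  products \<open>x $ i * x $ j\<close>, which determine \<open>x\<close> up to sign.\<close>

lemma gaussian_embedding_eqD:
  assumes "gaussian_embedding x = gaussian_embedding y"
  shows "x = y \<or> x = - y"
proof -
  have q: "(norm x)\<^sup>2 + (x $ i + x $ j)\<^sup>2 = (norm y)\<^sup>2 + (y $ i + y $ j)\<^sup>2" for i j
  proof -
    have "gaussian_embedding x $ i $ j = gaussian_embedding y $ i $ j" using assms by simp
    then show ?thesis unfolding gaussian_embedding_def by simp
  qed
  have nsq: "(norm z)\<^sup>2 = (\<Sum>i\<in>UNIV. (z $ i)\<^sup>2)" for z :: "real^'a"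
    by (simp add: norm_vec_def L2_set_def sum_nonneg)
  have tr: "(\<Sum>i\<in>UNIV. (norm z)\<^sup>2 + (z $ i + z $ i)\<^sup>2) = (real CARD('a) + 4) * (norm z)\<^sup>2" for z :: "real^'a"
  proof -
    have "(z $ i + z $ i)\<^sup>2 = 4 * (z $ i)\<^sup>2" for i by (simp add: power2_eq_square)
    then show ?thesis by (simp add: sum.distrib sum_distrib_left[symmetric] nsq[symmetric] distrib_right)
  qed
  have "(real CARD('a) + 4) * (norm x)\<^sup>2 = (real CARD('a) + 4) * (norm y)\<^sup>2"
    by (simp only: tr[symmetric] q)
  then have n: "(norm x)\<^sup>2 = (norm y)\<^sup>2" by simp
  have s: "(x $ i + x $ j)\<^sup>2 = (y $ i + y $ j)\<^sup>2" for i j using q[of i j] n by simp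
  have sq: "(x $ i)\<^sup>2 = (y $ i)\<^sup>2" for i
    using s[of i i] by (simp add: power2_eq_square)
  have pr: "x $ i * x $ j = y $ i * y $ j" for i j
    using s[of i j] sq[of i] sq[of j] by (simp add: power2_sum)
  show ?thesis
  proof (cases "y = 0")
    case True
    then show ?thesis using n by simp
  next
    case False
    then obtain k where k: "y $ k \<noteq> 0" by (auto simp: vec_eq_iff)
    have "x $ k = y $ k \<or> x $ k = - y $ k" using sq[of k] power2_eq_iff by blast
    then show ?thesis
    proof
      assume "x $ k = y $ k"
      then have "x $ j = y $ j" for j using pr[of k j] k by simp
      then show ?thesis by (simp add: vec_eq_iff)
    next
      assume xk: "x $ k = - y $ k"
      have "y $ k * (x $ j + y $ j) = 0" for j using pr[of k j] xk by (simp add: algebra_simps)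
      then have "x $ j = - y $ j" for j using k by (metis add_eq_0_iff2 mult_eq_0_iff)
      then show ?thesis by (simp add: vec_eq_iff)
    qed
  qed
qed

lemma gaussian_embedding_nonzero: "gaussian_embedding x \<noteq> 0"
proof
  assume "gaussian_embedding x = 0"
  then have "gaussian_embedding x $ i $ j = 0" for i j by simp
  then show False by (simp add: gaussian_embedding_def)
qed

lemma gaussian_sum_gaussian_embedding: "gaussian_sum (\<lambda>x. gaussian_embedding x $ i $ j)"
proof -
  have l: "linear (\<lambda>x::real^'a. x $ i + x $ j)" by (auto intro!: linearI simp: algebra_simps)
  obtain M :: "real^'a \<Rightarrow> real^'a" where M: "linear M"
    "\<And>x. (norm (M x))\<^sup>2 = (norm x)\<^sup>2 + (norm (x $ i + x $ j))\<^sup>2"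
    using exists_linear_norm_square_add[OF linear_id[unfolded id_def] l] by blast
  have "gaussian_embedding x $ i $ j = 1 * exp (- (norm (M x))\<^sup>2)" for x
    by (simp add: M(2) gaussian_embedding_def)
  then show ?thesis
    using gaussian_sum.gaussian[OF M(1), of 1] by (simp only:)
qed

lemma continuous_on_gaussian_embedding: "continuous_on S gaussian_embedding"
  unfolding gaussian_embedding_def[abs_def]
  by (intro continuous_on_vec_lambda continuous_on_exp continuous_on_minus continuous_on_add
      continuous_on_power continuous_on_norm continuous_on_component continuous_on_id)

lemma gaussian_embedding_at_infinity: "(gaussian_embedding \<longlongrightarrow> 0) at_infinity"
proof (intro vec_tendstoI)
  fix i j
  have "filterlim (\<lambda>x::real^'a. (norm x)\<^sup>2) at_top at_infinity"
    by (intro filterlim_pow_at_top filterlim_norm_at_top) simp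
  then have "((\<lambda>x::real^'a. exp (- (norm x)\<^sup>2)) \<longlongrightarrow> 0) at_infinity"
    by (intro filterlim_compose[OF exp_at_bot]) (simp add: filterlim_uminus_at_bot)
  then have "((\<lambda>x::real^'a. gaussian_embedding x $ i $ j) \<longlongrightarrow> 0) at_infinity"
    by (rule Lim_null_comparison[rotated]) (simp add: gaussian_embedding_def)
  then show "((\<lambda>x::real^'a. gaussian_embedding x $ i $ j) \<longlongrightarrow> 0 $ i $ j) at_infinity" by simp
qed

text \<open>The set is an image of the one-point compactification of \<open>S\<close>.\<close>

lemma compact_insert_limit_at_infinity:
  fixes u :: "'a::euclidean_space \<Rightarrow> 'b::topological_space"
  assumes "continuous_on UNIV u" "(u \<longlongrightarrow> l) at_infinity" "closed S"
  shows "compact (insert l (u ` S))"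
proof (rule compactI)
  fix C assume C: "\<forall>t\<in>C. open t" "insert l (u ` S) \<subseteq> \<Union>C"
  then obtain W where W: "W \<in> C" "l \<in> W" by auto
  then have "\<forall>\<^sub>F x in at_infinity. u x \<in> W"
    using assms(2) C topological_tendstoD by blast
  then obtain b where b: "\<And>x. norm x \<ge> b \<Longrightarrow> u x \<in> W" by (auto simp: eventually_at_infinity)
  have "compact (u ` (S \<inter> cball 0 b))"
    using assms by (intro compact_continuous_image closed_Int_compact)
      (auto intro: continuous_on_subset)
  then obtain D where D: "D \<subseteq> C" "finite D" "u ` (S \<inter> cball 0 b) \<subseteq> \<Union>D"
    by (rule compactE[of _ C]) (use C in auto)
  have "u x \<in> \<Union>(insert W D)" if "x \<in> S" for x
  proof (cases "norm x \<ge> b")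
    case False
    then have "u x \<in> u ` (S \<inter> cball 0 b)" using that by simp
    then show ?thesis using D(3) by blast
  qed (use b in blast)
  then show "\<exists>D\<subseteq>C. finite D \<and> insert l (u ` S) \<subseteq> \<Union>D"
    using D(1,2) W by (intro exI[of _ "insert W D"]) blast
qed

text \<open>The embedding identifies the quotient by \<open>x \<mapsto> - x\<close>, together with a point at infinity sent to
  \<open>0\<close>, with a compact set \<open>K\<close> of matrices. An even function of bounded support descends to a
  continuous function on \<open>K\<close>, and Stone--Weierstrass applies to the functions on \<open>K\<close> whose
  pullbacks are Gaussian sums; the matrix entries are among them.\<close>

lemma gaussian_sum_approximates_even:
  fixes \<phi> :: "real^'n \<Rightarrow> real"
  assumes cont: "continuous_on UNIV \<phi>" and even: "\<And>x. \<phi> (- x) = \<phi> x"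
    and supp: "bounded {x. \<phi> x \<noteq> 0}" and e: "e > 0"
  obtains w where "gaussian_sum w" "\<And>x. \<bar>\<phi> x - w x\<bar> < e"
proof -
  let ?u = "gaussian_embedding :: real^'n \<Rightarrow> _"
  define K where "K = insert 0 (range ?u)"
  define h where "h k = (if k = 0 then 0 else \<phi> (SOME x. ?u x = k))" for k
  have hu: "h (?u x) = \<phi> x" for x
  proof -
    have "?u (SOME y. ?u y = ?u x) = ?u x" by (rule someI) simp
    then have "(SOME y. ?u y = ?u x) = x \<or> (SOME y. ?u y = ?u x) = - x"
      by (rule gaussian_embedding_eqD)
    then show ?thesis using even by (auto simp: h_def gaussian_embedding_nonzero)
  qed
  have cpt: "compact (insert 0 (?u ` S))" if "closed S" for S
    by (intro compact_insert_limit_at_infinity continuous_on_gaussian_embedding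
        gaussian_embedding_at_infinity that)
  have K: "compact K" unfolding K_def by (rule cpt) simp
  have h: "continuous_on K h"
    unfolding continuous_on_closed_vimage[OF compact_imp_closed[OF K]]
  proof (intro allI impI)
    fix B :: "real set" assume B: "closed B"
    have cl: "closed (\<phi> -` B)" by (rule closed_vimage[OF B cont])
    \<comment> \<open>If \<open>0 \<in> B\<close>, the preimage contains the point at infinity; otherwise \<open>\<phi> -` B\<close> is compact.\<close>
    show "closed (h -` B \<inter> K)"
    proof (cases "0 \<in> B")
      case True
      then have "h -` B \<inter> K = insert 0 (?u ` (\<phi> -` B))"
        by (auto simp: K_def hu h_def[of 0])
      then show ?thesis using cpt[OF cl] compact_imp_closed by simp
    next
      case False
      then have "h -` B \<inter> K = ?u ` (\<phi> -` B)"
        by (auto simp: K_def hu h_def[of 0])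
      moreover have "bounded (\<phi> -` B)"
        by (rule bounded_subset[OF supp]) (use False in auto)
      ultimately show ?thesis
        using cl by (metis compact_continuous_image compact_eq_bounded_closed continuous_on_gaussian_embedding)
    qed
  qed
  define P where "P f \<longleftrightarrow> continuous_on K f \<and> gaussian_sum (\<lambda>x. f (?u x))" for f
  have "\<exists>g. P g \<and> (\<forall>k\<in>K. \<bar>h k - g k\<bar> < e)"
  proof (rule Stone_Weierstrass_HOL[OF K _ _ _ _ _ h e])
    fix k k' assume "k \<in> K \<and> k' \<in> K \<and> k \<noteq> k'"
    then have "\<exists>i j. k $ i $ j \<noteq> k' $ i $ j" by (simp add: vec_eq_iff)
    then obtain i j where "k $ i $ j \<noteq> k' $ i $ j" by blast
    moreover have "P (\<lambda>k. k $ i $ j)"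
      unfolding P_def by (intro conjI gaussian_sum_gaussian_embedding continuous_intros)
    ultimately show "\<exists>f. P f \<and> f k \<noteq> f k'" by blast
  next
    show "P (\<lambda>_. a)" for a by (simp add: P_def gaussian_sum_const)
    show "P f \<Longrightarrow> continuous_on K f" for f by (simp add: P_def)
    show "P f \<and> P g \<Longrightarrow> P (\<lambda>k. f k + g k)" for f g
      unfolding P_def by (intro conjI continuous_on_add gaussian_sum.add) blast+
    show "P f \<and> P g \<Longrightarrow> P (\<lambda>k. f k * g k)" for f g
      unfolding P_def by (intro conjI continuous_on_mult gaussian_sum_mult) blast+
  qed
  then obtain g where g: "gaussian_sum (\<lambda>x. g (?u x))" "\<forall>k\<in>K. \<bar>h k - g k\<bar> < e"
    unfolding P_def by blast
  have "\<bar>\<phi> x - g (?u x)\<bar> < e" for x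
  proof -
    have "?u x \<in> K" by (simp add: K_def)
    then show ?thesis using g(2) hu by metis
  qed
  then show ?thesis by (rule that[OF g(1)])
qed

section \<open>Convergence on test functions\<close>

lemma locally_finite_integrable_bounded_support:
  fixes f :: "'a::euclidean_space \<Rightarrow> real"
  assumes "locally_finite_borel_measure \<mu>" "f \<in> borel_measurable borel"
    "\<And>x. \<bar>f x\<bar> \<le> K" "\<And>x. norm x \<ge> R \<Longrightarrow> f x = 0"
  shows "integrable \<mu> f"
proof -
  have s: "sets \<mu> = sets borel" using assms(1) by (simp add: locally_finite_borel_measure_def)
  show ?thesis
  proof (rule integrable_bounded_support)
    show "f \<in> borel_measurable \<mu>" using assms(2) measurable_cong_sets[OF s refl] by blast
    show "ball 0 R \<in> sets \<mu>" using s by simp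
    show "emeasure \<mu> (ball 0 R) < \<infinity>"
      by (rule locally_finite_borel_measure_bounded[OF assms(1)]) simp
    show "\<bar>f x\<bar> \<le> K" for x by (rule assms(3))
    show "x \<notin> ball 0 R \<Longrightarrow> f x = 0" for x using assms(4) by simp
  qed
qed

lemma locally_finite_lborel: "locally_finite_borel_measure (lborel :: 'a::euclidean_space measure)"
  unfolding locally_finite_borel_measure_def
proof (intro conjI allI)
  fix x :: 'a
  show "\<exists>U. open U \<and> x \<in> U \<and> emeasure lborel U < \<infinity>"
    by (intro exI[of _ "ball x 1"] conjI emeasure_bounded_finite) auto
qed simp

lemma truncated_gaussian_tendsto:
  fixes L :: "'a::euclidean_space \<Rightarrow> 'a"
  assumes \<nu>: "\<forall>\<^sub>F \<alpha> in \<F>. locally_finite_borel_measure (\<nu> \<alpha>)"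
    and ell: "\<And>(L::'a \<Rightarrow> 'a) r. linear L \<Longrightarrow> inj L \<Longrightarrow>
      ((\<lambda>\<alpha>. measure (\<nu> \<alpha>) {x. norm (L x) < r}) \<longlongrightarrow> c * measure lborel {x. norm (L x) < r}) \<F>"
    and L: "linear L" "inj L" and R: "R > 0"
  shows "((\<lambda>\<alpha>. LINT x|\<nu> \<alpha>. truncated_gaussian R L x) \<longlongrightarrow> c * (LINT x|lborel. truncated_gaussian R L x)) \<F>"
proof (rule integral_tendsto_of_superlevels[OF \<nu> truncated_gaussian_measurable[OF L(1)]])
  show "bounded {x. 0 < truncated_gaussian R L x}"
    using bounded_ellipsoid[OF L] by (simp add: truncated_gaussian_support[OF R])
  fix s :: real assume "s \<ge> 0"
  then obtain r where "{x. s < truncated_gaussian R L x} = {x. norm (L x) < r}"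
    by (rule truncated_gaussian_superlevel)
  then show "((\<lambda>\<alpha>. measure (\<nu> \<alpha>) {x. s < truncated_gaussian R L x}) \<longlongrightarrow>
      c * measure lborel {x. s < truncated_gaussian R L x}) \<F>"
    using ell[OF L] by simp
qed (rule truncated_gaussian_bounds)+

text \<open>The factor \<open>exp (- (norm x)\<^sup>2)\<close> makes every quadratic form in the sum at least \<open>(norm x)\<^sup>2\<close>.
  Hence all forms are definite, so that the hypothesis on ellipsoids applies, and all truncations at
  level \<open>exp (- R\<^sup>2)\<close> vanish outside the ball of radius \<open>R\<close>. The constant \<open>K\<close> must not depend on \<open>R\<close>,
  as \<open>R\<close> is chosen last.\<close>

lemma gaussian_sum_truncation:
  fixes w :: "'a::euclidean_space \<Rightarrow> real"
  assumes \<nu>: "\<forall>\<^sub>F \<alpha> in \<F>. locally_finite_borel_measure (\<nu> \<alpha>)"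
    and ell: "\<And>(L::'a \<Rightarrow> 'a) r. linear L \<Longrightarrow> inj L \<Longrightarrow>
      ((\<lambda>\<alpha>. measure (\<nu> \<alpha>) {x. norm (L x) < r}) \<longlongrightarrow> c * measure lborel {x. norm (L x) < r}) \<F>"
    and w: "gaussian_sum w"
  shows "\<exists>K\<ge>0. \<forall>R>0. \<exists>p. p \<in> borel_measurable borel \<and> (\<forall>x. \<bar>p x\<bar> \<le> K) \<and>
    (\<forall>x. norm x \<ge> R \<longrightarrow> p x = 0) \<and> (\<forall>x. \<bar>exp (- (norm x)\<^sup>2) * w x - p x\<bar> \<le> K * exp (- R\<^sup>2)) \<and>
    ((\<lambda>\<alpha>. LINT x|\<nu> \<alpha>. p x) \<longlongrightarrow> c * (LINT x|lborel. p x)) \<F>"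
  using w
proof induction
  case (gaussian L a)
  obtain M :: "'a \<Rightarrow> 'a" where M: "linear M" "\<And>x. (norm (M x))\<^sup>2 = (norm x)\<^sup>2 + (norm (L x))\<^sup>2"
    using exists_linear_norm_square_add[OF linear_id[unfolded id_def] gaussian] by blast
  have "inj M"
    unfolding linear_injective_0[OF M(1)]
  proof (intro allI impI)
    fix x assume "M x = 0"
    moreover have "(norm x)\<^sup>2 \<le> (norm (M x))\<^sup>2" by (simp add: M(2))
    ultimately show "x = 0" by simp
  qed
  show ?case
  proof (intro exI[of _ "\<bar>a\<bar>"] conjI allI impI)
    fix R :: real assume R: "R > 0"
    let ?p = "\<lambda>x. a * truncated_gaussian R M x"
    show "\<exists>p. p \<in> borel_measurable borel \<and> (\<forall>x. \<bar>p x\<bar> \<le> \<bar>a\<bar>) \<and>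
      (\<forall>x. norm x \<ge> R \<longrightarrow> p x = 0) \<and>
      (\<forall>x. \<bar>exp (- (norm x)\<^sup>2) * (a * exp (- (norm (L x))\<^sup>2)) - p x\<bar> \<le> \<bar>a\<bar> * exp (- R\<^sup>2)) \<and>
      ((\<lambda>\<alpha>. LINT x|\<nu> \<alpha>. p x) \<longlongrightarrow> c * (LINT x|lborel. p x)) \<F>"
    proof (intro exI[of _ ?p] conjI allI impI)
      show "?p \<in> borel_measurable borel"
        by (intro borel_measurable_times borel_measurable_const truncated_gaussian_measurable M)
      show "\<bar>?p x\<bar> \<le> \<bar>a\<bar>" for x
        using truncated_gaussian_bounds(1,2)[of R M x] by (simp add: abs_mult mult_left_le)
      show "?p x = 0" if "norm x \<ge> R" for x
      proof -
        have "R\<^sup>2 \<le> (norm x)\<^sup>2" using that R by (intro power_mono) auto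
        also have "\<dots> \<le> (norm (M x))\<^sup>2" by (simp add: M(2))
        finally show ?thesis by (simp add: truncated_gaussian_def)
      qed
      show "\<bar>exp (- (norm x)\<^sup>2) * (a * exp (- (norm (L x))\<^sup>2)) - ?p x\<bar> \<le> \<bar>a\<bar> * exp (- R\<^sup>2)" for x
      proof -
        have "exp (- (norm (M x))\<^sup>2) = exp (- (norm x)\<^sup>2) * exp (- (norm (L x))\<^sup>2)"
          by (simp add: M(2) mult_exp_exp)
        then have "exp (- (norm x)\<^sup>2) * (a * exp (- (norm (L x))\<^sup>2)) - ?p x
            = a * (exp (- (norm (M x))\<^sup>2) - truncated_gaussian R M x)"
          by (simp add: algebra_simps)
        then show ?thesis
          using truncated_gaussian_bounds(3)[of M x R] by (simp add: abs_mult mult_left_mono)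
      qed
      have "((\<lambda>\<alpha>. a * (LINT x|\<nu> \<alpha>. truncated_gaussian R M x)) \<longlongrightarrow>
          a * (c * (LINT x|lborel. truncated_gaussian R M x))) \<F>"
        by (intro tendsto_mult_left truncated_gaussian_tendsto[OF \<nu> ell M(1) \<open>inj M\<close> R])
      then show "((\<lambda>\<alpha>. LINT x|\<nu> \<alpha>. ?p x) \<longlongrightarrow> c * (LINT x|lborel. ?p x)) \<F>"
        by (simp add: mult.left_commute)
    qed
  qed simp
next
  case (add v w)
  obtain K1 where K1: "K1 \<ge> 0" "\<And>R. R > 0 \<Longrightarrow> \<exists>p. p \<in> borel_measurable borel \<and> (\<forall>x. \<bar>p x\<bar> \<le> K1) \<and>
    (\<forall>x. norm x \<ge> R \<longrightarrow> p x = 0) \<and> (\<forall>x. \<bar>exp (- (norm x)\<^sup>2) * v x - p x\<bar> \<le> K1 * exp (- R\<^sup>2)) \<and>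
    ((\<lambda>\<alpha>. LINT x|\<nu> \<alpha>. p x) \<longlongrightarrow> c * (LINT x|lborel. p x)) \<F>"
    using add.IH(1) by blast
  obtain K2 where K2: "K2 \<ge> 0" "\<And>R. R > 0 \<Longrightarrow> \<exists>p. p \<in> borel_measurable borel \<and> (\<forall>x. \<bar>p x\<bar> \<le> K2) \<and>
    (\<forall>x. norm x \<ge> R \<longrightarrow> p x = 0) \<and> (\<forall>x. \<bar>exp (- (norm x)\<^sup>2) * w x - p x\<bar> \<le> K2 * exp (- R\<^sup>2)) \<and>
    ((\<lambda>\<alpha>. LINT x|\<nu> \<alpha>. p x) \<longlongrightarrow> c * (LINT x|lborel. p x)) \<F>"
    using add.IH(2) by blast
  show ?case
  proof (intro exI[of _ "K1 + K2"] conjI allI impI)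
    fix R :: real assume R: "R > 0"
    obtain p where p: "p \<in> borel_measurable borel" "\<And>x. \<bar>p x\<bar> \<le> K1" "\<And>x. norm x \<ge> R \<Longrightarrow> p x = 0"
      "\<And>x. \<bar>exp (- (norm x)\<^sup>2) * v x - p x\<bar> \<le> K1 * exp (- R\<^sup>2)"
      "((\<lambda>\<alpha>. LINT x|\<nu> \<alpha>. p x) \<longlongrightarrow> c * (LINT x|lborel. p x)) \<F>"
      using K1(2)[OF R] by blast
    obtain q where q: "q \<in> borel_measurable borel" "\<And>x. \<bar>q x\<bar> \<le> K2" "\<And>x. norm x \<ge> R \<Longrightarrow> q x = 0"
      "\<And>x. \<bar>exp (- (norm x)\<^sup>2) * w x - q x\<bar> \<le> K2 * exp (- R\<^sup>2)"
      "((\<lambda>\<alpha>. LINT x|\<nu> \<alpha>. q x) \<longlongrightarrow> c * (LINT x|lborel. q x)) \<F>"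
      using K2(2)[OF R] by blast
    have int: "integrable \<mu> p" "integrable \<mu> q" if "locally_finite_borel_measure \<mu>" for \<mu>
      by (rule locally_finite_integrable_bounded_support[OF that p(1-3)]; assumption)
        (rule locally_finite_integrable_bounded_support[OF that q(1-3)]; assumption)
    let ?s = "\<lambda>x. p x + q x"
    show "\<exists>p. p \<in> borel_measurable borel \<and> (\<forall>x. \<bar>p x\<bar> \<le> K1 + K2) \<and>
      (\<forall>x. norm x \<ge> R \<longrightarrow> p x = 0) \<and>
      (\<forall>x. \<bar>exp (- (norm x)\<^sup>2) * (v x + w x) - p x\<bar> \<le> (K1 + K2) * exp (- R\<^sup>2)) \<and>
      ((\<lambda>\<alpha>. LINT x|\<nu> \<alpha>. p x) \<longlongrightarrow> c * (LINT x|lborel. p x)) \<F>"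
    proof (intro exI[of _ ?s] conjI allI impI)
      show "?s \<in> borel_measurable borel" using p(1) q(1) by simp
      show "\<bar>?s x\<bar> \<le> K1 + K2" for x using p(2)[of x] q(2)[of x] by linarith
      show "norm x \<ge> R \<Longrightarrow> ?s x = 0" for x using p(3) q(3) by simp
      show "\<bar>exp (- (norm x)\<^sup>2) * (v x + w x) - ?s x\<bar> \<le> (K1 + K2) * exp (- R\<^sup>2)" for x
        using p(4)[of x] q(4)[of x] by (simp add: distrib_left distrib_right)
      have "((\<lambda>\<alpha>. (LINT x|\<nu> \<alpha>. p x) + (LINT x|\<nu> \<alpha>. q x)) \<longlongrightarrow>
          c * (LINT x|lborel. p x) + c * (LINT x|lborel. q x)) \<F>"
        by (intro tendsto_add p(5) q(5))
      moreover have "\<forall>\<^sub>F \<alpha> in \<F>. (LINT x|\<nu> \<alpha>. p x) + (LINT x|\<nu> \<alpha>. q x) = (LINT x|\<nu> \<alpha>. ?s x)"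
        using \<nu> by eventually_elim (simp add: int)
      ultimately have "((\<lambda>\<alpha>. LINT x|\<nu> \<alpha>. ?s x) \<longlongrightarrow>
          c * (LINT x|lborel. p x) + c * (LINT x|lborel. q x)) \<F>"
        by (rule Lim_transform_eventually)
      then show "((\<lambda>\<alpha>. LINT x|\<nu> \<alpha>. ?s x) \<longlongrightarrow> c * (LINT x|lborel. ?s x)) \<F>"
        using int[OF locally_finite_lborel] by (simp add: distrib_left)
    qed
  qed (use K1 K2 in simp)
qed

lemma integrable_continuous_bounded_support:
  fixes f :: "'a::euclidean_space \<Rightarrow> real"
  assumes \<mu>: "locally_finite_borel_measure \<mu>"
    and cont: "continuous_on UNIV f" and supp: "bounded {x. f x \<noteq> 0}"
  shows "integrable \<mu> f"
proof -
  obtain b where b: "\<And>x. f x \<noteq> 0 \<Longrightarrow> norm x \<le> b"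
    using supp by (auto simp: bounded_iff)
  have "compact (f ` cball 0 b)"
    by (intro compact_continuous_image continuous_on_subset[OF cont]) auto
  then obtain M where M: "\<And>x. norm x \<le> b \<Longrightarrow> \<bar>f x\<bar> \<le> M"
    using compact_imp_bounded by (force simp: bounded_iff)
  show ?thesis
  proof (rule locally_finite_integrable_bounded_support[OF \<mu> borel_measurable_continuous_onI[OF cont]])
    show "\<bar>f x\<bar> \<le> max M 0" for x
      using M[of x] b[of x] by (cases "f x = 0") (auto simp: le_max_iff_disj)
    show "f x = 0" if "norm x \<ge> b + 1" for x
      using b[of x] that by fastforce
  qed
qed

lemma integral_diff_le_truncated_gaussian:
  fixes f p :: "'a::euclidean_space \<Rightarrow> real"
  assumes \<mu>: "locally_finite_borel_measure \<mu>" and int: "integrable \<mu> f" "integrable \<mu> p"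
    and R: "R > 0"
    and le: "\<And>x. \<bar>f x - p x\<bar> \<le> \<epsilon> * truncated_gaussian R (\<lambda>x. x) x + \<delta> * indicat_real (ball 0 R) x"
  shows "\<bar>(LINT x|\<mu>. f x) - (LINT x|\<mu>. p x)\<bar>
    \<le> \<epsilon> * (LINT x|\<mu>. truncated_gaussian R (\<lambda>x. x) x) + \<delta> * measure \<mu> (ball 0 R)"
proof -
  let ?q = "truncated_gaussian R (\<lambda>x::'a. x)"
  have s: "sets \<mu> = sets borel" using \<mu> by (simp add: locally_finite_borel_measure_def)
  have intq: "integrable \<mu> ?q"
  proof (rule locally_finite_integrable_bounded_support[OF \<mu>])
    show "?q \<in> borel_measurable borel" by (intro truncated_gaussian_measurable linear_id[unfolded id_def])
    show "\<bar>?q x\<bar> \<le> 1" for x using truncated_gaussian_bounds(1,2)[of R "\<lambda>x. x" x] by simp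
    show "norm x \<ge> R \<Longrightarrow> ?q x = 0" for x
      using truncated_gaussian_support[OF R, of "\<lambda>x. x" x] truncated_gaussian_bounds(1)[of R "\<lambda>x. x" x] by linarith
  qed
  have "emeasure \<mu> (ball 0 R) < \<infinity>" by (rule locally_finite_borel_measure_bounded[OF \<mu>]) simp
  then have inti: "integrable \<mu> (indicat_real (ball 0 R))" using s by simp
  have "\<bar>(LINT x|\<mu>. f x) - (LINT x|\<mu>. p x)\<bar> = \<bar>LINT x|\<mu>. f x - p x\<bar>" using int by simp
  also have "\<dots> \<le> (LINT x|\<mu>. \<bar>f x - p x\<bar>)" by (rule integral_abs_bound)
  also have "\<dots> \<le> (LINT x|\<mu>. \<epsilon> * ?q x + \<delta> * indicat_real (ball 0 R) x)"
    by (rule integral_mono) (use int intq inti le in auto)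
  also have "\<dots> = \<epsilon> * (LINT x|\<mu>. ?q x) + \<delta> * measure \<mu> (ball 0 R)"
    using intq inti s by (simp add: sets_eq_imp_space_eq[OF s])
  finally show ?thesis .
qed

text \<open>Constants are chosen in the order \<open>\<epsilon>\<close>, Gaussian sum \<open>w\<close>, its constant \<open>K\<close>, radius \<open>R\<close>. The bound \<open>C\<close>
  for \<open>\<integral> q dm\<close> is independent of \<open>R\<close>, and \<open>R\<close> is so large that the error \<open>\<delta>\<close>
  on the ball of radius \<open>R\<close> has total mass at most \<open>\<epsilon>\<close>.\<close>

lemma even_test_function_tendsto:
  fixes \<nu> :: "'i \<Rightarrow> (real^'n) measure" and \<psi> :: "real^'n \<Rightarrow> real"
  assumes \<nu>: "\<forall>\<^sub>F \<alpha> in \<F>. locally_finite_borel_measure (\<nu> \<alpha>)"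
    and ell: "\<And>(L::real^'n \<Rightarrow> real^'n) r. linear L \<Longrightarrow> inj L \<Longrightarrow>
      ((\<lambda>\<alpha>. measure (\<nu> \<alpha>) {x. norm (L x) < r}) \<longlongrightarrow> c * measure lborel {x. norm (L x) < r}) \<F>"
    and cont: "continuous_on UNIV \<psi>" and even: "\<And>x. \<psi> (- x) = \<psi> x"
    and supp: "bounded {x. \<psi> x \<noteq> 0}"
  shows "((\<lambda>\<alpha>. LINT x|\<nu> \<alpha>. \<psi> x) \<longlongrightarrow> c * (LINT x|lborel. \<psi> x)) \<F>"
proof (rule tendstoI)
  fix e :: real assume e: "e > 0"
  let ?N = "CARD('n)" and ?B = "\<lambda>R. ball (0::real^'n) R" and ?v = "unit_ball_vol (real CARD('n))"
  define C where "C = (LINT x::real^'n|lborel. exp (- (norm x)\<^sup>2))"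
  have C: "C \<ge> 0" unfolding C_def by (rule Bochner_Integration.integral_nonneg) simp
  \<comment> \<open>The errors below add up to \<open>\<epsilon> * D\<close>.\<close>
  define D where "D = 2 * (\<bar>c\<bar> * (C + 1)) + 3"
  have D: "D > 0" using C unfolding D_def by (intro add_nonneg_pos) auto
  define \<epsilon> where "\<epsilon> = e / D"
  have \<epsilon>: "\<epsilon> > 0" "\<epsilon> * D = e" using e D by (auto simp: \<epsilon>_def)
  obtain w where w: "gaussian_sum w" "\<And>x. \<bar>\<psi> x * exp ((norm x)\<^sup>2) - w x\<bar> < \<epsilon>"
  proof (rule gaussian_sum_approximates_even[of "\<lambda>x. \<psi> x * exp ((norm x)\<^sup>2)" \<epsilon>])
    show "continuous_on UNIV (\<lambda>x. \<psi> x * exp ((norm x)\<^sup>2))"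
      by (intro continuous_intros cont)
    show "bounded {x. \<psi> x * exp ((norm x)\<^sup>2) \<noteq> 0}" using supp by simp
  qed (use even \<epsilon> in auto)
  obtain K where K: "K \<ge> 0" "\<And>R. R > 0 \<Longrightarrow> \<exists>p. p \<in> borel_measurable borel \<and> (\<forall>x. \<bar>p x\<bar> \<le> K) \<and>
    (\<forall>x. norm x \<ge> R \<longrightarrow> p x = 0) \<and> (\<forall>x. \<bar>exp (- (norm x)\<^sup>2) * w x - p x\<bar> \<le> K * exp (- R\<^sup>2)) \<and>
    ((\<lambda>\<alpha>. LINT x|\<nu> \<alpha>. p x) \<longlongrightarrow> c * (LINT x|lborel. p x)) \<F>"
    using gaussian_sum_truncation[OF \<nu> ell w(1)] by blast
  obtain b where b: "\<And>x. \<psi> x \<noteq> 0 \<Longrightarrow> norm x \<le> b"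
    using supp by (auto simp: bounded_iff)
  have "((\<lambda>R. (\<epsilon> + K) * ?v * (R ^ ?N / exp R)) \<longlongrightarrow> (\<epsilon> + K) * ?v * 0) at_top"
    by (intro tendsto_mult_left tendsto_power_div_exp_0)
  then have "\<forall>\<^sub>F R in at_top. (\<epsilon> + K) * ?v * (R ^ ?N / exp R) < \<epsilon>"
    using \<epsilon>(1) by (simp add: order_tendstoD(2))
  then have "\<forall>\<^sub>F R in at_top. (\<epsilon> + K) * ?v * (R ^ ?N / exp R) < \<epsilon> \<and> R > max b 1"
    using eventually_gt_at_top by (rule eventually_conj)
  then obtain R where R: "(\<epsilon> + K) * ?v * (R ^ ?N / exp R) < \<epsilon>" "R > b" "R > 1"
    by (auto dest!: eventually_happens)
  then have R0: "R > 0" by simp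
  define \<delta> where "\<delta> = (\<epsilon> + K) * exp (- R\<^sup>2)"
  have \<delta>0: "\<delta> \<ge> 0" using \<epsilon> K by (simp add: \<delta>_def)
  have \<delta>: "\<delta> * measure lborel (?B R) \<le> \<epsilon>"
  proof -
    have "R \<le> R\<^sup>2" using R by (simp add: power2_eq_square)
    then have "exp (- R\<^sup>2) \<le> inverse (exp R)" by (simp add: exp_minus[symmetric])
    then have "\<delta> * measure lborel (?B R) \<le> (\<epsilon> + K) * inverse (exp R) * measure lborel (?B R)"
      unfolding \<delta>_def using \<epsilon> K by (intro mult_right_mono mult_left_mono) auto
    also have "\<dots> = (\<epsilon> + K) * ?v * (R ^ ?N / exp R)"
      using R0 by (simp add: content_ball divide_inverse mult_ac)
    finally show ?thesis using R by simp
  qed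
  obtain p where p: "p \<in> borel_measurable borel" "\<And>x. \<bar>p x\<bar> \<le> K" "\<And>x. norm x \<ge> R \<Longrightarrow> p x = 0"
    "\<And>x. \<bar>exp (- (norm x)\<^sup>2) * w x - p x\<bar> \<le> K * exp (- R\<^sup>2)"
    "((\<lambda>\<alpha>. LINT x|\<nu> \<alpha>. p x) \<longlongrightarrow> c * (LINT x|lborel. p x)) \<F>"
    using K(2)[OF R0] by blast
  let ?q = "truncated_gaussian R (\<lambda>x::real^'n. x)"
  have pw: "\<bar>\<psi> x - p x\<bar> \<le> \<epsilon> * ?q x + \<delta> * indicat_real (?B R) x" for x
  proof (cases "norm x < R")
    case False
    then have "\<psi> x = 0" "p x = 0" using b[of x] R p(3)[of x] by (force, simp)
    then show ?thesis using \<epsilon> \<delta>0 truncated_gaussian_bounds(1)[of R "\<lambda>x. x" x] by simp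
  next
    case True
    have "\<psi> x - exp (- (norm x)\<^sup>2) * w x = exp (- (norm x)\<^sup>2) * (\<psi> x * exp ((norm x)\<^sup>2) - w x)"
      by (simp add: right_diff_distrib exp_minus)
    then have "\<bar>\<psi> x - exp (- (norm x)\<^sup>2) * w x\<bar> \<le> exp (- (norm x)\<^sup>2) * \<epsilon>"
      using w(2)[of x] by (simp add: abs_mult)
    also have "\<dots> \<le> (?q x + exp (- R\<^sup>2)) * \<epsilon>"
      using truncated_gaussian_bounds(3)[of "\<lambda>x. x" x R] \<epsilon> by (intro mult_right_mono) auto
    finally show ?thesis
      using p(4)[of x] True by (simp add: \<delta>_def algebra_simps)
  qed
  have diff: "\<bar>(LINT x|\<mu>. \<psi> x) - (LINT x|\<mu>. p x)\<bar> \<le> \<epsilon> * (LINT x|\<mu>. ?q x) + \<delta> * measure \<mu> (?B R)"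
    if \<mu>: "locally_finite_borel_measure \<mu>" for \<mu>
  proof (rule integral_diff_le_truncated_gaussian[OF \<mu> _ _ R0 pw])
    show "integrable \<mu> \<psi>"
      by (rule integrable_continuous_bounded_support[OF \<mu> cont supp])
    show "integrable \<mu> p" by (rule locally_finite_integrable_bounded_support[OF \<mu> p(1-3)])
  qed
  have qC: "(LINT x|lborel. ?q x) \<le> C"
    unfolding C_def
  proof (rule integral_mono')
    show "?q x \<le> exp (- (norm x)\<^sup>2)" for x by (simp add: truncated_gaussian_def)
  qed (use gaussian_integrable in auto)
  have q0: "(LINT x|lborel. ?q x) \<ge> 0" by (intro Bochner_Integration.integral_nonneg truncated_gaussian_bounds)
  have "\<epsilon> * (LINT x|lborel. ?q x) \<le> \<epsilon> * C" using qC \<epsilon> by simp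
  then have dl: "\<bar>(LINT x|lborel. \<psi> x) - (LINT x|lborel. p x)\<bar> \<le> \<epsilon> * (C + 1)"
    using diff[OF locally_finite_lborel] \<delta> by (simp add: distrib_left)
  have "\<bar>c * (LINT x|lborel. p x) - c * (LINT x|lborel. \<psi> x)\<bar> = \<bar>c\<bar> * \<bar>(LINT x|lborel. \<psi> x) - (LINT x|lborel. p x)\<bar>"
    by (simp add: abs_mult[symmetric] right_diff_distrib abs_minus_commute)
  also have "\<dots> \<le> \<bar>c\<bar> * (\<epsilon> * (C + 1))" by (intro mult_left_mono dl) simp
  finally have d3: "\<bar>c * (LINT x|lborel. p x) - c * (LINT x|lborel. \<psi> x)\<bar> \<le> \<bar>c\<bar> * (\<epsilon> * (C + 1))" .
  have id: "linear (\<lambda>x::real^'n. x)" "inj (\<lambda>x::real^'n. x)"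
    using linear_id[unfolded id_def] by (auto simp: inj_def)
  have "c * (LINT x|lborel. ?q x) \<le> \<bar>c\<bar> * C"
    using qC q0 by (intro mult_mono) auto
  then have cq: "c * (LINT x|lborel. ?q x) < \<bar>c\<bar> * C + 1" by linarith
  have "\<forall>\<^sub>F \<alpha> in \<F>. (LINT x|\<nu> \<alpha>. ?q x) < \<bar>c\<bar> * C + 1"
    by (rule order_tendstoD(2)[OF truncated_gaussian_tendsto[OF \<nu> ell id R0] cq])
  moreover have "\<forall>\<^sub>F \<alpha> in \<F>. \<delta> * measure (\<nu> \<alpha>) (?B R) < \<bar>c\<bar> * \<epsilon> + \<epsilon>"
  proof (rule order_tendstoD(2))
    show "((\<lambda>\<alpha>. \<delta> * measure (\<nu> \<alpha>) (?B R)) \<longlongrightarrow> \<delta> * (c * measure lborel (?B R))) \<F>"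
      using ell[OF id, of R] by (intro tendsto_mult_left) (simp add: ball_def)
    have "\<delta> * (c * measure lborel (?B R)) = c * (\<delta> * measure lborel (?B R))" by simp
    also have "\<dots> \<le> \<bar>c\<bar> * (\<delta> * measure lborel (?B R))"
      using \<delta>0 by (intro mult_right_mono) auto
    also have "\<dots> \<le> \<bar>c\<bar> * \<epsilon>" by (intro mult_left_mono \<delta>) simp
    finally show "\<delta> * (c * measure lborel (?B R)) < \<bar>c\<bar> * \<epsilon> + \<epsilon>" using \<epsilon> by linarith
  qed
  moreover have "\<forall>\<^sub>F \<alpha> in \<F>. \<bar>(LINT x|\<nu> \<alpha>. p x) - c * (LINT x|lborel. p x)\<bar> < \<epsilon>"
    using tendstoD[OF p(5) \<epsilon>(1)] by (simp add: dist_real_def)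
  ultimately show "\<forall>\<^sub>F \<alpha> in \<F>. dist (LINT x|\<nu> \<alpha>. \<psi> x) (c * (LINT x|lborel. \<psi> x)) < e"
    using \<nu>
  proof eventually_elim
    case (elim \<alpha>)
    have "\<epsilon> * (LINT x|\<nu> \<alpha>. ?q x) \<le> \<epsilon> * (\<bar>c\<bar> * C + 1)"
      using elim(1) \<epsilon> by simp
    with diff[OF elim(4)] elim(2)
    have "\<bar>(LINT x|\<nu> \<alpha>. \<psi> x) - (LINT x|\<nu> \<alpha>. p x)\<bar> \<le> \<epsilon> * (\<bar>c\<bar> * C + 1) + (\<bar>c\<bar> * \<epsilon> + \<epsilon>)" by linarith
    with elim(3) d3 have "\<bar>(LINT x|\<nu> \<alpha>. \<psi> x) - c * (LINT x|lborel. \<psi> x)\<bar>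
        < \<epsilon> * (\<bar>c\<bar> * C + 1) + (\<bar>c\<bar> * \<epsilon> + \<epsilon>) + \<epsilon> + \<bar>c\<bar> * (\<epsilon> * (C + 1))" by linarith
    also have "\<dots> = \<epsilon> * D" by (simp add: D_def algebra_simps)
    finally show ?case using \<epsilon> by (simp add: dist_real_def)
  qed
qed

lemma mem_uminus_image_iff: "x \<in> uminus ` U \<longleftrightarrow> - x \<in> U"
  for x :: "'a::group_add"
  by (metis image_iff minus_minus)

lemma even_measure_integral_uminus:
  fixes \<mu> :: "'a::euclidean_space measure" and f :: "'a \<Rightarrow> real"
  assumes "sets \<mu> = sets borel" "even_measure \<mu>" "f \<in> borel_measurable borel"
  shows "(LINT x|\<mu>. f (- x)) = (LINT x|\<mu>. f x)"
proof -
  have m: "uminus \<in> measurable \<mu> (borel :: 'a measure)"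
  proof -
    have "(\<lambda>x::'a. - x) \<in> measurable borel borel"
      by (intro borel_measurable_continuous_onI continuous_on_minus continuous_on_id)
    then show ?thesis using measurable_cong_sets[OF assms(1) refl] by blast
  qed
  have "distr \<mu> borel uminus = \<mu>"
  proof (rule measure_eqI)
    fix A assume "A \<in> sets (distr \<mu> borel uminus)"
    then have A: "A \<in> sets (borel :: 'a measure)" by simp
    have "uminus -` A \<inter> space \<mu> = uminus ` A"
      using sets_eq_imp_space_eq[OF assms(1)] by (auto simp: mem_uminus_image_iff)
    then show "emeasure (distr \<mu> borel uminus) A = emeasure \<mu> A"
      using A m assms(2) by (simp add: emeasure_distr even_measure_def)
  qed (simp add: assms)
  then show ?thesis
    using integral_distr[OF m assms(3)] by simp
qed

lemma even_measure_lborel: "even_measure (lborel :: 'a::euclidean_space measure)"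
  unfolding even_measure_def
proof
  fix U :: "'a set" assume U: "U \<in> sets borel"
  have "uminus ` U = uminus -` U" by (auto simp: mem_uminus_image_iff)
  moreover have "distr lborel borel uminus = (lborel :: 'a measure)"
    by (subst (2) lborel_affine[of "-1" 0]) (auto simp: density_1 one_ennreal_def[symmetric])
  then have "emeasure (lborel :: 'a measure) U = emeasure (distr lborel borel uminus) U"
    by simp
  ultimately show "emeasure lborel (uminus ` U) = emeasure lborel U"
    using U by (simp add: emeasure_distr)
qed

theorem theorem10p1:
  fixes A :: "'i set" and le :: "'i \<Rightarrow> 'i \<Rightarrow> bool"
    and \<nu> :: "'i \<Rightarrow> (real^'n) measure"
    and c :: real
    and F :: "((real^'n^'n) \<times> real) set"
  assumes "CARD('n) > 1"
    and "directed_preorder A le"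
    and "\<And>\<alpha>. \<alpha> \<in> A \<Longrightarrow> locally_finite_borel_measure (\<nu> \<alpha>)"
    and "\<And>\<alpha>. \<alpha> \<in> A \<Longrightarrow> even_measure (\<nu> \<alpha>)"
    and "F \<subseteq> special_linear \<times> {0<..}"
    and "special_linear \<times> {0<..} \<subseteq> closure F"
    and "\<And>g t. (g, t) \<in> F \<Longrightarrow>
           ((\<lambda>\<alpha>. measure (\<nu> \<alpha>) ((\<lambda>x. t *\<^sub>R (g *v x)) ` ball 0 1))
              \<longlongrightarrow> c * t ^ CARD('n) * (surface_area (sphere (0 :: real^'n) 1) / real CARD('n)))
             (net_filter A le)"
  shows "\<forall>\<psi> :: real^'n \<Rightarrow> real.
           continuous_on UNIV \<psi> \<and> compact (closure {x. \<psi> x \<noteq> 0}) \<longrightarrow>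
           ((\<lambda>\<alpha>. LINT x|\<nu> \<alpha>. \<psi> x) \<longlongrightarrow> c * (LINT x|lborel. \<psi> x)) (net_filter A le)"
proof (intro allI impI)
  fix \<psi> :: "real^'n \<Rightarrow> real"
  assume "continuous_on UNIV \<psi> \<and> compact (closure {x. \<psi> x \<noteq> 0})"
  then have cont: "continuous_on UNIV \<psi>" and supp: "bounded {x. \<psi> x \<noteq> 0}" by auto
  let ?\<F> = "net_filter A le"
  have inA: "\<forall>\<^sub>F \<alpha> in ?\<F>. \<alpha> \<in> A"
  proof -
    obtain a where "a \<in> A" using assms(2) by (auto simp: directed_preorder_def)
    then show ?thesis
      unfolding net_filter_def by (rule eventually_INF1) (simp add: eventually_principal)
  qed
  have \<nu>: "\<forall>\<^sub>F \<alpha> in ?\<F>. locally_finite_borel_measure (\<nu> \<alpha>)"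
    using inA by eventually_elim (rule assms(3))
  have ell: "((\<lambda>\<alpha>. measure (\<nu> \<alpha>) {x. norm (L x) < r}) \<longlongrightarrow> c * measure lborel {x. norm (L x) < r}) ?\<F>"
    if "linear L" "inj L" for L :: "real^'n \<Rightarrow> real^'n" and r
    using assms(7) by (intro ellipsoid_measure_convergence[OF \<nu> assms(5,6) _ that])
      (simp add: surface_area_unit_sphere)
  define \<psi>e where "\<psi>e x = (\<psi> x + \<psi> (- x)) / 2" for x
  have cont': "continuous_on UNIV (\<lambda>x. \<psi> (- x))"
    by (rule continuous_on_compose2[OF cont]) (auto intro: continuous_intros)
  have "bounded (uminus ` {x. \<psi> x \<noteq> 0})" using supp by simp
  then have supp': "bounded {x. \<psi> (- x) \<noteq> 0}"
    by (rule bounded_subset) (auto simp: mem_uminus_image_iff)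
  have even_int: "(LINT x|\<mu>. \<psi>e x) = (LINT x|\<mu>. \<psi> x)"
    if \<mu>: "locally_finite_borel_measure \<mu>" "even_measure \<mu>" for \<mu>
  proof -
    have s: "sets \<mu> = sets borel" using \<mu> by (simp add: locally_finite_borel_measure_def)
    have "(LINT x|\<mu>. \<psi> (- x)) = (LINT x|\<mu>. \<psi> x)"
      by (rule even_measure_integral_uminus[OF s \<mu>(2) borel_measurable_continuous_onI[OF cont]])
    then show ?thesis
      unfolding \<psi>e_def using integrable_continuous_bounded_support[OF \<mu>(1) cont supp]
        integrable_continuous_bounded_support[OF \<mu>(1) cont' supp'] by simp
  qed
  have "((\<lambda>\<alpha>. LINT x|\<nu> \<alpha>. \<psi>e x) \<longlongrightarrow> c * (LINT x|lborel. \<psi>e x)) ?\<F>"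
  proof (rule even_test_function_tendsto[OF \<nu> ell])
    show "continuous_on UNIV \<psi>e" unfolding \<psi>e_def[abs_def] by (intro continuous_intros cont cont') simp
    show "\<psi>e (- x) = \<psi>e x" for x by (simp add: \<psi>e_def add.commute)
    show "bounded {x. \<psi>e x \<noteq> 0}"
      by (rule bounded_subset[OF bounded_Un[THEN iffD2, OF conjI[OF supp supp']]]) (auto simp: \<psi>e_def)
  qed
  then have "((\<lambda>\<alpha>. LINT x|\<nu> \<alpha>. \<psi>e x) \<longlongrightarrow> c * (LINT x|lborel. \<psi> x)) ?\<F>"
    by (simp add: even_int[OF locally_finite_lborel even_measure_lborel])
  moreover have "\<forall>\<^sub>F \<alpha> in ?\<F>. (LINT x|\<nu> \<alpha>. \<psi>e x) = (LINT x|\<nu> \<alpha>. \<psi> x)"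
    using inA by eventually_elim (intro even_int assms(3,4))
  ultimately show "((\<lambda>\<alpha>. LINT x|\<nu> \<alpha>. \<psi> x) \<longlongrightarrow> c * (LINT x|lborel. \<psi> x)) ?\<F>"
    by (rule Lim_transform_eventually)
qed

end
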